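(* Let $F=g/\omega$ and $\widehat F=\widehat g/\widehat\omega$ be two projectively equivalent Kropina metrics on a manifold $M$ satisfying the following conditions: (i) $\ker\omega$ is non-integrable, i.e. $\omega\wedge d\omega\neq0$ at almost every point; (ii) $g$ is non-degenerate on $\ker\omega$ and $\widehat g$ is non-degenerate on $\ker\widehat\omega$. Then $\omega=\alpha\widehat\omega$ for a certain non-vanishing function $\alpha$, and there exist a constant $c\neq0$ and a closed 1-form $\beta$ such that $\widehat F=cF+\beta$.
   Context: A Kropina metric on a manifold $M$ is a function $F(x,\xi)=g_x(\xi,\xi)/\omega_x(\xi)$, defined for $\xi\in T_xM$ with $\omega(\xi)\neq0$, where $\omega$ is a nowhere vanishing 1-form and $g$ is a symmetric 2-tensor field of arbitrary signature (possibly degenerate). The identity $\widehat F=cF+\beta$ means $\widehat F(x,\xi)=cF(x,\xi)+\beta_x(\xi)$. A geodesic of $F=g/\omega$ is a smooth regular curve $\gamma(t)$ which solves the Euler-Lagrange equation of the Lagrangian $F$ and satisfies $\omega(\gamma'(t))\neq0$ for all $t$; geodesics are considered without preferred parameterization. A set of curves on $M$ is called sufficiently big if for every $p\in M$ the set of tangent vectors at $p$ to curves of the set contains a nonempty open subset of $T_pM$. Two Kropina metrics are projectively equivalent if there exists a sufficiently big set of curves which are geodesics (up to reparameterization) of both metrics. All objects are assumed sufficiently smooth.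
   Formalization: The manifold M is assumed connected; on a disconnected manifold c would only be locally constant (e.g. F̂ = F on one component and F̂ = 2F on another), so the claim with a single constant c fails there. *)

theory Defs
  imports "HOL-Analysis.Analysis"
begin

text \<open>The predicates \<open>Ck_on\<close> and \<open>smooth_on\<close> are meant for open sets \<open>S\<close> only.\<close>

primrec Ck_on ::
  "nat \<Rightarrow> 'a::euclidean_space set \<Rightarrow> ('a \<Rightarrow> 'b::real_normed_vector) \<Rightarrow> bool"
where
  "Ck_on 0 S f \<longleftrightarrow> continuous_on S f"
| "Ck_on (Suc k) S f \<longleftrightarrow>
     (\<forall>x\<in>S. f differentiable (at x)) \<and>
     (\<forall>v. Ck_on k S (\<lambda>x. frechet_derivative f (at x) v))"

definition smooth_on ::
  "'a::euclidean_space set \<Rightarrow> ('a \<Rightarrow> 'b::real_normed_vector) \<Rightarrow> bool"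
  where "smooth_on S f \<longleftrightarrow> (\<forall>k. Ck_on k S f)"


section \<open>Manifolds\<close>

text \<open>The manifold is the whole type \<open>'m\<close>, modelled on \<open>'e\<close>; a chart is a pair of its domain
  and its coordinate map. Hausdorff and second countable are imposed through the sort of \<open>'m\<close>.
  The atlas need not be maximal.\<close>

type_synonym ('m, 'e) chart = "'m set \<times> ('m \<Rightarrow> 'e)"

abbreviation cdom :: "('m, 'e) chart \<Rightarrow> 'm set" where "cdom \<equiv> fst"
abbreviation coord :: "('m, 'e) chart \<Rightarrow> 'm \<Rightarrow> 'e" where "coord \<equiv> snd"

definition cinv :: "('m, 'e) chart \<Rightarrow> 'e \<Rightarrow> 'm"
  where "cinv c = inv_into (cdom c) (coord c)"

definition is_chart :: "('m::topological_space, 'e::euclidean_space) chart \<Rightarrow> bool"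
  where "is_chart c \<longleftrightarrow>
     open (cdom c) \<and> open (coord c ` cdom c) \<and>
     homeomorphism (cdom c) (coord c ` cdom c) (coord c) (cinv c)"

definition smooth_atlas ::
  "('m::{t2_space,second_countable_topology}, 'e::euclidean_space) chart set \<Rightarrow> bool"
  where "smooth_atlas A \<longleftrightarrow>
     (\<forall>c\<in>A. is_chart c) \<and> (\<Union>c\<in>A. cdom c) = UNIV \<and>
     (\<forall>c\<in>A. \<forall>d\<in>A. smooth_on (coord c ` (cdom c \<inter> cdom d)) (coord d \<circ> cinv c))"

definition smooth_function ::
  "('m::topological_space, 'e::euclidean_space) chart set \<Rightarrow> ('m \<Rightarrow> real) \<Rightarrow> bool"
  where "smooth_function A f \<longleftrightarrow> (\<forall>c\<in>A. smooth_on (coord c ` cdom c) (f \<circ> cinv c))"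


section \<open>Tensor fields\<close>

text \<open>A tangent vector at \<open>p\<close> is represented by its coordinate vector in a chart around \<open>p\<close>; a
  vector \<open>v\<close> in the chart \<open>c\<close> and the vector \<open>transfer c d p v\<close> in the chart \<open>d\<close> are the same
  element of the tangent space. A function on the tangent bundle is accordingly a family
  \<open>f c p v\<close> indexed by charts \<open>c\<close>, points \<open>p\<close> in the domain of \<open>c\<close> and coordinate vectors \<open>v\<close>,
  which respects this identification. Values at \<open>p\<close> outside the domain of \<open>c\<close> are
  irrelevant.\<close>

definition transfer ::
  "('m, 'e::euclidean_space) chart \<Rightarrow> ('m, 'e) chart \<Rightarrow> 'm \<Rightarrow> 'e \<Rightarrow> 'e"
  where "transfer c d p = frechet_derivative (coord d \<circ> cinv c) (at (coord c p))"

type_synonym ('m, 'e) tangent_function = "('m, 'e) chart \<Rightarrow> 'm \<Rightarrow> 'e \<Rightarrow> real"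
type_synonym ('m, 'e) two_tensor = "('m, 'e) chart \<Rightarrow> 'm \<Rightarrow> 'e \<Rightarrow> 'e \<Rightarrow> real"

definition one_form ::
  "('m::topological_space, 'e::euclidean_space) chart set \<Rightarrow> ('m, 'e) tangent_function \<Rightarrow> bool"
  where "one_form A \<omega> \<longleftrightarrow>
     (\<forall>c\<in>A. \<forall>p\<in>cdom c. linear (\<omega> c p)) \<and>
     (\<forall>c\<in>A. \<forall>v. smooth_on (coord c ` cdom c) (\<lambda>x. \<omega> c (cinv c x) v)) \<and>
     (\<forall>c\<in>A. \<forall>d\<in>A. \<forall>p\<in>cdom c \<inter> cdom d. \<forall>v. \<omega> d p (transfer c d p v) = \<omega> c p v)"

definition symmetric_two_tensor ::
  "('m::topological_space, 'e::euclidean_space) chart set \<Rightarrow> ('m, 'e) two_tensor \<Rightarrow> bool"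
  where "symmetric_two_tensor A g \<longleftrightarrow>
     (\<forall>c\<in>A. \<forall>p\<in>cdom c. bilinear (g c p)) \<and>
     (\<forall>c\<in>A. \<forall>p\<in>cdom c. \<forall>u v. g c p u v = g c p v u) \<and>
     (\<forall>c\<in>A. \<forall>u v. smooth_on (coord c ` cdom c) (\<lambda>x. g c (cinv c x) u v)) \<and>
     (\<forall>c\<in>A. \<forall>d\<in>A. \<forall>p\<in>cdom c \<inter> cdom d. \<forall>u v.
        g d p (transfer c d p u) (transfer c d p v) = g c p u v)"

definition ext_deriv ::
  "('m, 'e::euclidean_space) tangent_function \<Rightarrow> ('m, 'e) two_tensor"
  where "ext_deriv \<omega> c p u v =
     frechet_derivative (\<lambda>x. \<omega> c (cinv c x) v) (at (coord c p)) u -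
     frechet_derivative (\<lambda>x. \<omega> c (cinv c x) u) (at (coord c p)) v"

definition closed_form ::
  "('m, 'e::euclidean_space) chart set \<Rightarrow> ('m, 'e) tangent_function \<Rightarrow> bool"
  where "closed_form A \<beta> \<longleftrightarrow> (\<forall>c\<in>A. \<forall>p\<in>cdom c. \<forall>u v. ext_deriv \<beta> c p u v = 0)"

definition wedge12 ::
  "('m, 'e) tangent_function \<Rightarrow> ('m, 'e) two_tensor \<Rightarrow>
   ('m, 'e) chart \<Rightarrow> 'm \<Rightarrow> 'e \<Rightarrow> 'e \<Rightarrow> 'e \<Rightarrow> real"
  where "wedge12 \<omega> \<theta> c p u v w =
     \<omega> c p u * \<theta> c p v w + \<omega> c p v * \<theta> c p w u + \<omega> c p w * \<theta> c p u v"

definition almost_every_point ::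
  "('m, 'e::euclidean_space) chart set \<Rightarrow> (('m, 'e) chart \<Rightarrow> 'm \<Rightarrow> bool) \<Rightarrow> bool"
  where "almost_every_point A P \<longleftrightarrow>
     (\<forall>c\<in>A. negligible (coord c ` {p \<in> cdom c. \<not> P c p}))"

definition kernel_nonintegrable_ae ::
  "('m, 'e::euclidean_space) chart set \<Rightarrow> ('m, 'e) tangent_function \<Rightarrow> bool"
  where "kernel_nonintegrable_ae A \<omega> \<longleftrightarrow>
     almost_every_point A (\<lambda>c p. \<exists>u v w. wedge12 \<omega> (ext_deriv \<omega>) c p u v w \<noteq> 0)"

definition nondegenerate_on_kernel ::
  "('m, 'e::euclidean_space) chart set \<Rightarrow> ('m, 'e) two_tensor \<Rightarrow>
   ('m, 'e) tangent_function \<Rightarrow> bool"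
  where "nondegenerate_on_kernel A g \<omega> \<longleftrightarrow>
     (\<forall>c\<in>A. \<forall>p\<in>cdom c. \<forall>u. \<omega> c p u = 0 \<and> (\<forall>v. \<omega> c p v = 0 \<longrightarrow> g c p u v = 0) \<longrightarrow> u = 0)"


section \<open>Curves and geodesics\<close>

text \<open>A parameterized curve is a map together with its parameter interval.\<close>

type_synonym 'm curve = "real set \<times> (real \<Rightarrow> 'm)"

definition velocity ::
  "('m, 'e::euclidean_space) chart \<Rightarrow> (real \<Rightarrow> 'm) \<Rightarrow> real \<Rightarrow> 'e"
  where "velocity c \<gamma> t = vector_derivative (coord c \<circ> \<gamma>) (at t)"

definition smooth_regular_curve ::
  "('m::topological_space, 'e::euclidean_space) chart set \<Rightarrow> 'm curve \<Rightarrow> bool"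
  where "smooth_regular_curve A = (\<lambda>(I, \<gamma>).
     open I \<and> is_interval I \<and> I \<noteq> {} \<and> continuous_on I \<gamma> \<and>
     (\<forall>c\<in>A. smooth_on {t \<in> I. \<gamma> t \<in> cdom c} (coord c \<circ> \<gamma>)) \<and>
     (\<forall>c\<in>A. \<forall>t\<in>I. \<gamma> t \<in> cdom c \<longrightarrow> velocity c \<gamma> t \<noteq> 0))"

text \<open>The Euler-Lagrange equations, contracted with an arbitrary constant coordinate
  vector \<open>v\<close>.\<close>

definition euler_lagrange ::
  "('m, 'e::euclidean_space) chart set \<Rightarrow> ('m, 'e) tangent_function \<Rightarrow> 'm curve \<Rightarrow> bool"
  where "euler_lagrange A L = (\<lambda>(I, \<gamma>).
     \<forall>c\<in>A. \<forall>t\<in>I. \<gamma> t \<in> cdom c \<longrightarrow> (\<forall>v.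
       ((\<lambda>s. frechet_derivative (\<lambda>\<xi>. L c (\<gamma> s) \<xi>) (at (velocity c \<gamma> s)) v)
        has_real_derivative
        frechet_derivative (\<lambda>x. L c (cinv c x) (velocity c \<gamma> t)) (at (coord c (\<gamma> t))) v)
       (at t)))"

definition reparameterization :: "'m curve \<Rightarrow> 'm curve \<Rightarrow> bool"
  where "reparameterization = (\<lambda>(I, \<gamma>) (J, \<delta>).
     \<exists>\<phi>. bij_betw \<phi> J I \<and> smooth_on J \<phi> \<and> (\<forall>t\<in>J. deriv \<phi> t \<noteq> 0) \<and> \<delta> = \<gamma> \<circ> \<phi>)"

text \<open>That every tangent space receives a nonempty open set of tangent vectors does not depend on
  the chart around \<open>p\<close> in which these are expressed.\<close>

definition sufficiently_big ::
  "('m::topological_space, 'e::euclidean_space) chart set \<Rightarrow> 'm curve set \<Rightarrow> bool"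
  where "sufficiently_big A S \<longleftrightarrow>
     (\<forall>\<Gamma>\<in>S. smooth_regular_curve A \<Gamma>) \<and>
     (\<forall>c\<in>A. \<forall>p\<in>cdom c. \<exists>W. open W \<and> W \<noteq> {} \<and>
        W \<subseteq> {velocity c \<gamma> t | I \<gamma> t. (I, \<gamma>) \<in> S \<and> t \<in> I \<and> \<gamma> t = p})"


section \<open>Kropina metrics\<close>

definition kropina_pair ::
  "('m::topological_space, 'e::euclidean_space) chart set \<Rightarrow> ('m, 'e) two_tensor \<Rightarrow>
   ('m, 'e) tangent_function \<Rightarrow> bool"
  where "kropina_pair A g \<omega> \<longleftrightarrow>
     symmetric_two_tensor A g \<and> one_form A \<omega> \<and>
     (\<forall>c\<in>A. \<forall>p\<in>cdom c. \<exists>v. \<omega> c p v \<noteq> 0)"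

text \<open>Only meaningful for vectors \<open>\<xi>\<close> with \<open>\<omega> c p \<xi> \<noteq> 0\<close>; elsewhere it takes the junk value
  \<open>0\<close>.\<close>

definition kropina ::
  "('m, 'e) two_tensor \<Rightarrow> ('m, 'e) tangent_function \<Rightarrow> ('m, 'e) tangent_function"
  where "kropina g \<omega> c p \<xi> = g c p \<xi> \<xi> / \<omega> c p \<xi>"

definition kropina_geodesic ::
  "('m::topological_space, 'e::euclidean_space) chart set \<Rightarrow> ('m, 'e) two_tensor \<Rightarrow>
   ('m, 'e) tangent_function \<Rightarrow> 'm curve \<Rightarrow> bool"
  where "kropina_geodesic A g \<omega> \<Gamma> \<longleftrightarrow>
     smooth_regular_curve A \<Gamma> \<and>
     (\<forall>c\<in>A. \<forall>t\<in>fst \<Gamma>. snd \<Gamma> t \<in> cdom c \<longrightarrow>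
        \<omega> c (snd \<Gamma> t) (velocity c (snd \<Gamma>) t) \<noteq> 0) \<and>
     euler_lagrange A (kropina g \<omega>) \<Gamma>"

definition unparameterized_geodesic ::
  "('m::topological_space, 'e::euclidean_space) chart set \<Rightarrow> ('m, 'e) two_tensor \<Rightarrow>
   ('m, 'e) tangent_function \<Rightarrow> 'm curve \<Rightarrow> bool"
  where "unparameterized_geodesic A g \<omega> \<Gamma> \<longleftrightarrow>
     (\<exists>\<Delta>. reparameterization \<Gamma> \<Delta> \<and> kropina_geodesic A g \<omega> \<Delta>)"

definition projectively_equivalent ::
  "('m::topological_space, 'e::euclidean_space) chart set \<Rightarrow>
   ('m, 'e) two_tensor \<Rightarrow> ('m, 'e) tangent_function \<Rightarrow>
   ('m, 'e) two_tensor \<Rightarrow> ('m, 'e) tangent_function \<Rightarrow> bool"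
  where "projectively_equivalent A g \<omega> gh \<omega>h \<longleftrightarrow>
     (\<exists>S. sufficiently_big A S \<and>
        (\<forall>\<Gamma>\<in>S. unparameterized_geodesic A g \<omega> \<Gamma> \<and> unparameterized_geodesic A gh \<omega>h \<Gamma>))"

end

theory Submission
  imports Defs
begin

text \<open>For \<open>v \<in> ker \<omega>\<close> the Euler-Lagrange equation of \<open>g/\<omega>\<close>, multiplied by \<open>\<omega>(\<xi>)\<^sup>2/2\<close>, is polynomial
  in the velocity \<open>\<xi>\<close> and linear in the acceleration \<open>a\<close>, and it determines the vector
  \<open>\<omega>(\<xi>)a - \<omega>(a)\<xi> \<in> ker \<omega>\<close> as a polynomial in \<open>\<xi>\<close>. Common geodesics in an open set of directions
  thus give polynomial identities in \<open>\<xi>\<close>, which may be evaluated at \<open>\<xi> \<in> ker \<omega>\<close>, although no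
  geodesic is tangent to \<open>ker \<omega>\<close>. Where \<open>d\<omega>\<close> does not vanish on \<open>ker \<omega>\<close>, this forces the two kernels
  to coincide and, after rescaling to \<open>\<omega> = \<omega>h\<close>, forces \<open>gh = C g\<close> on \<open>ker \<omega>\<close>; both relations extend
  to all points by continuity. Then \<open>gh/\<omega> = C g/\<omega> + \<beta>\<close> for a 1-form \<open>\<beta>\<close>, and the difference of the
  Euler-Lagrange equations is
  \<open>2 dC(\<xi>) g(\<xi>,v) - dC(v) g(\<xi>,\<xi>) + \<omega>(\<xi>) d\<beta>(\<xi>,v) = 0\<close>, which yields \<open>dC = 0\<close> and \<open>d\<beta> = 0\<close>
  pointwise.\<close>

section \<open>Polynomial functions\<close>

text \<open>Two obstacles shape the argument. For indefinite \<open>g\<close> the factor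
  g(\<xi>,\<xi>) vanishes on many vectors of ker \<omega>; it is removed by cancellation between
  polynomials, also on ker \<omega>, for which a single kernel vector with nonzero factor suffices.
  Restriction to ker \<omega> removes every derivative of \<open>g\<close> from the force. Let
  \<theta> be the skew part d\<omega>(u,v) - d\<omega>(v,u) and R its \<open>g\<close>-dual on ker
  \<omega>. What remains is g(\<xi>,\<xi>) gh(R\<xi>,v) = gh(\<xi>,\<xi>) \<theta>(\<xi>,v). As R is
  additive, the ratio gh(\<xi>,\<xi>)/g(\<xi>,\<xi>) takes the same value at \<xi> and \<eta>, where
  defined, if \<theta>(\<xi>,\<eta>) is nonzero, and a nonzero \<theta> links enough vectors to make
  it constant. The closing cancellation of dC and d\<beta> rests on one kernel vector with
  g(\<eta>,\<eta>) nonzero, which exists at every point, including those where d\<omega> vanishes on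
  ker \<omega>.\<close>

lemma polynomial_function_times:
  fixes f g :: "'a::real_normed_vector \<Rightarrow> real"
  assumes "polynomial_function f" and "polynomial_function g"
  shows "polynomial_function (\<lambda>x. f x * g x)"
  using polynomial_function_mult[OF assms] by simp

lemma linear_expand:
  fixes f :: "'a::euclidean_space \<Rightarrow> 'b::real_vector"
  assumes "linear f"
  shows "f x = (\<Sum>b\<in>Basis. (x \<bullet> b) *\<^sub>R f b)"
proof -
  have "f x = f (\<Sum>b\<in>Basis. (x \<bullet> b) *\<^sub>R b)"
    by (simp add: euclidean_representation)
  then show ?thesis
    using assms by (simp add: linear_sum linear_cmul)
qed

lemma bilinear_expand:
  fixes g :: "'a::euclidean_space \<Rightarrow> 'a \<Rightarrow> real"
  assumes "bilinear g"
  shows "g u v = (\<Sum>b\<in>Basis. \<Sum>b'\<in>Basis. (u \<bullet> b) * (v \<bullet> b') * g b b')"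
proof -
  have "g u v = (\<Sum>b\<in>Basis. (u \<bullet> b) * g b v)"
    using linear_expand[of "\<lambda>u. g u v" u] assms by (simp add: bilinear_def)
  also have "\<dots> = (\<Sum>b\<in>Basis. (u \<bullet> b) * (\<Sum>b'\<in>Basis. (v \<bullet> b') * g b b'))"
    using linear_expand[of "g _" v] assms by (simp add: bilinear_def)
  finally show ?thesis
    by (simp add: sum_distrib_left mult.assoc)
qed

lemma polynomial_function_linear_comp:
  fixes f :: "'a::euclidean_space \<Rightarrow> 'b::real_normed_vector"
  assumes "linear f" and "polynomial_function p"
  shows "polynomial_function (\<lambda>x. f (p x))"
  unfolding polynomial_function_def
proof (intro allI impI)
  fix h :: "'b \<Rightarrow> real"
  assume "bounded_linear h"
  then have "bounded_linear (h \<circ> f)"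
    using assms(1) by (simp add: bounded_linear_compose linear_conv_bounded_linear o_def)
  then have "real_polynomial_function ((h \<circ> f) \<circ> p)"
    using assms(2) unfolding polynomial_function_def by blast
  then show "real_polynomial_function (h \<circ> (\<lambda>x. f (p x)))"
    by (simp add: o_def)
qed

lemma polynomial_function_inner:
  fixes p :: "'a::real_normed_vector \<Rightarrow> 'b::euclidean_space"
  assumes "polynomial_function p"
  shows "polynomial_function (\<lambda>x. p x \<bullet> b)"
  by (rule polynomial_function_linear_comp[OF _ assms]) (auto intro: linearI inner_left_distrib)

lemma polynomial_function_bilinear:
  fixes g :: "'a::euclidean_space \<Rightarrow> 'a \<Rightarrow> real"
  assumes "bilinear g" and "polynomial_function p" and "polynomial_function q"
  shows "polynomial_function (\<lambda>x. g (p x) (q x))"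
  unfolding bilinear_expand[OF assms(1), of "p _"]
  by (intro polynomial_function_sum polynomial_function_times polynomial_function_inner
      polynomial_function_const assms finite_Basis)

lemmas polynomial_function_intros =
  polynomial_function_times polynomial_function_add polynomial_function_diff
  polynomial_function_minus polynomial_function_mult polynomial_function_const
  polynomial_function_id polynomial_function_inner

lemma polynomial_function_comp:
  assumes "polynomial_function p" and "polynomial_function q"
  shows "polynomial_function (\<lambda>x. q (p x))"
  using assms real_polynomial_function_compose[OF assms(1)]
  by (auto simp: polynomial_function_def o_def)

text \<open>On the line from a point of \<open>W\<close> to \<open>y\<close> the function is a
  polynomial in one variable, and openness of \<open>W\<close> gives it infinitely many
  roots.\<close>

lemma polynomial_function_zero_on_open:
  fixes f :: "'a::real_normed_vector \<Rightarrow> real"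
  assumes f: "polynomial_function f" and W: "open W" "W \<noteq> {}"
    and zero: "\<And>x. x \<in> W \<Longrightarrow> f x = 0"
  shows "f y = 0"
proof -
  obtain x0 where x0: "x0 \<in> W" using W by auto
  define h where "h t = f (x0 + t *\<^sub>R (y - x0))" for t :: real
  have "polynomial_function h"
    unfolding h_def by (intro polynomial_function_comp[OF _ f] polynomial_function_intros)
  then obtain a n where h: "h = (\<lambda>t. \<Sum>i\<le>n. a i * t ^ i)"
    using real_polynomial_function_iff_sum[of h] by (auto simp: real_polynomial_function_eq)
  have "open ((\<lambda>t::real. x0 + t *\<^sub>R (y - x0)) -` W)"
    by (intro open_vimage W continuous_intros)
  moreover have "0 \<in> (\<lambda>t::real. x0 + t *\<^sub>R (y - x0)) -` W"
    using x0 by simp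
  ultimately have "\<not> finite ((\<lambda>t::real. x0 + t *\<^sub>R (y - x0)) -` W)"
    using finite_imp_not_open by blast
  moreover have "(\<lambda>t::real. x0 + t *\<^sub>R (y - x0)) -` W \<subseteq> {t. h t = 0}"
    using zero by (auto simp: h_def)
  ultimately have "\<not> finite {t. h t = 0}"
    using finite_subset by blast
  then have "\<forall>i\<le>n. a i = 0"
    using polyfun_finite_roots[of a n] by (simp add: h)
  then have "h 1 = 0"
    by (simp add: h)
  then show ?thesis
    by (simp add: h_def)
qed

text \<open>Absence of zero divisors: \<open>g\<close> vanishes on the open set where
  \<open>f\<close> does not, and this set is nonempty. It licenses every cancellation of a factor
  below.\<close>

lemma polynomial_function_mult_eq_0:
  fixes f g :: "'a::euclidean_space \<Rightarrow> real"
  assumes f: "polynomial_function f" and g: "polynomial_function g"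
    and zero: "\<And>x. f x * g x = 0" and "f x0 \<noteq> 0"
  shows "g y = 0"
proof (rule polynomial_function_zero_on_open[OF g])
  have "continuous_on UNIV f"
    using continuous_on_polymonial_function f by blast
  then have "open (f -` (- {0}))"
    by (intro open_vimage) auto
  then show "open {x. f x \<noteq> 0}"
    by (simp add: vimage_def)
  show "{x. f x \<noteq> 0} \<noteq> {}"
    using assms by auto
  show "g x = 0" if "x \<in> {x. f x \<noteq> 0}" for x
    using zero[of x] that by auto
qed

section \<open>Geodesics at a point\<close>

definition kernel_proj :: "('a::real_vector \<Rightarrow> real) \<Rightarrow> 'a \<Rightarrow> 'a \<Rightarrow> 'a"
  where "kernel_proj \<omega> e u = u - \<omega> u *\<^sub>R e"

lemma kernel_proj:
  assumes "linear \<omega>" and "\<omega> e = 1"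
  shows linear_kernel_proj: "linear (kernel_proj \<omega> e)"
    and kernel_proj_in: "\<omega> (kernel_proj \<omega> e u) = 0"
    and kernel_proj_ident: "\<omega> u = 0 \<Longrightarrow> kernel_proj \<omega> e u = u"
  using assms
  by (auto intro!: linearI simp: kernel_proj_def linear_add linear_cmul linear_diff algebra_simps)

lemma polynomial_function_kernel_proj:
  fixes \<omega> :: "'a::euclidean_space \<Rightarrow> real"
  assumes "linear \<omega>" and "\<omega> e = 1"
  shows "polynomial_function (kernel_proj \<omega> e)"
  using polynomial_function_linear_comp[OF linear_kernel_proj[OF assms] polynomial_function_id] .

lemma normalized_vector:
  fixes \<omega> :: "'a::real_vector \<Rightarrow> real"
  assumes "linear \<omega>" and "\<omega> v \<noteq> 0"
  obtains e where "\<omega> e = 1"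
  using that[of "inverse (\<omega> v) *\<^sub>R v"] assms by (simp add: linear_cmul)

text \<open>The Euler-Lagrange equation of \<open>g/\<omega>\<close> for velocity \<open>\<xi>\<close> and acceleration \<open>a\<close>, multiplied by
  \<open>\<omega>(\<xi>)\<^sup>2/2\<close> and contracted with \<open>v \<in> ker \<omega>\<close>; \<open>d\<omega>\<close> and \<open>dg\<close> are the coordinate derivatives, the
  direction of differentiation being the first argument.\<close>

definition force ::
  "('a \<Rightarrow> real) \<Rightarrow> ('a \<Rightarrow> 'a \<Rightarrow> real) \<Rightarrow> ('a \<Rightarrow> 'a \<Rightarrow> real) \<Rightarrow> ('a \<Rightarrow> 'a \<Rightarrow> 'a \<Rightarrow> real) \<Rightarrow>
   'a \<Rightarrow> 'a \<Rightarrow> real"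
  where "force \<omega> d\<omega> g dg \<xi> v =
    g \<xi> v * d\<omega> \<xi> \<xi> + g \<xi> \<xi> * (d\<omega> \<xi> v - d\<omega> v \<xi>) / 2 - \<omega> \<xi> * (dg \<xi> \<xi> v - dg v \<xi> \<xi> / 2)"

text \<open>The acceleration occurs only through \<omega>(\<xi>) a - \<omega>(a) \<xi>, so a
  multiple of \<xi> added to \<open>a\<close> has no effect, as is to be expected for curves without
  preferred parameterization.\<close>

definition geodesic_2jet ::
  "('a \<Rightarrow> real) \<Rightarrow> ('a \<Rightarrow> 'a \<Rightarrow> real) \<Rightarrow> ('a \<Rightarrow> 'a \<Rightarrow> real) \<Rightarrow> ('a \<Rightarrow> 'a \<Rightarrow> 'a \<Rightarrow> real) \<Rightarrow>
   'a \<Rightarrow> 'a \<Rightarrow> bool"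
  where "geodesic_2jet \<omega> d\<omega> g dg \<xi> a \<longleftrightarrow>
    (\<forall>v. \<omega> v = 0 \<longrightarrow> \<omega> \<xi> * g a v - \<omega> a * g \<xi> v = force \<omega> d\<omega> g dg \<xi> v)"

text \<open>Values and first coordinate derivatives of the two fields at one point, treated as
  independent algebraic data; everything in this locale is algebra in a single tangent
  space.\<close>

locale kropina_1jet =
  fixes \<omega> :: "'a::euclidean_space \<Rightarrow> real"
    and d\<omega> g :: "'a \<Rightarrow> 'a \<Rightarrow> real"
    and dg :: "'a \<Rightarrow> 'a \<Rightarrow> 'a \<Rightarrow> real"
  assumes linear_form: "linear \<omega>" and nonzero: "\<exists>v. \<omega> v \<noteq> 0"
    and bilinear_dform: "bilinear d\<omega>"
    and bilinear_tensor: "bilinear g" and sym: "g u v = g v u"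
    and bilinear_dtensor: "\<And>z. bilinear (dg z)" and linear_dtensor: "\<And>u v. linear (\<lambda>z. dg z u v)"
    and nondegenerate: "\<And>u. \<omega> u = 0 \<Longrightarrow> (\<And>v. \<omega> v = 0 \<Longrightarrow> g u v = 0) \<Longrightarrow> u = 0"
begin

lemmas tensor_simps =
  bilinear_ladd[OF bilinear_tensor] bilinear_radd[OF bilinear_tensor]
  bilinear_lsub[OF bilinear_tensor] bilinear_rsub[OF bilinear_tensor]
  bilinear_lmul[OF bilinear_tensor] bilinear_rmul[OF bilinear_tensor]
  bilinear_lzero[OF bilinear_tensor] bilinear_rzero[OF bilinear_tensor]

lemmas dform_simps =
  bilinear_ladd[OF bilinear_dform] bilinear_radd[OF bilinear_dform]
  bilinear_lsub[OF bilinear_dform] bilinear_rsub[OF bilinear_dform]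
  bilinear_lmul[OF bilinear_dform] bilinear_rmul[OF bilinear_dform]

lemmas dtensor_simps =
  bilinear_ladd[OF bilinear_dtensor] bilinear_radd[OF bilinear_dtensor]
  bilinear_lsub[OF bilinear_dtensor] bilinear_rsub[OF bilinear_dtensor]
  bilinear_lmul[OF bilinear_dtensor] bilinear_rmul[OF bilinear_dtensor]
  linear_add[OF linear_dtensor] linear_diff[OF linear_dtensor] linear_cmul[OF linear_dtensor]

lemmas form_simps =
  linear_add[OF linear_form] linear_diff[OF linear_form] linear_cmul[OF linear_form]
  linear_0[OF linear_form]

lemma exists_unit: obtains e where "\<omega> e = 1"
  using nonzero normalized_vector[OF linear_form] by blast

lemma kernel_eqI:
  assumes "\<omega> u = 0" and "\<omega> u' = 0" and "\<And>v. \<omega> v = 0 \<Longrightarrow> g u v = g u' v"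
  shows "u = u'"
  using nondegenerate[of "u - u'"] assms by (simp add: form_simps tensor_simps)

lemma linear_force: "linear (force \<omega> d\<omega> g dg \<xi>)"
  by (rule linearI)
    (auto simp: force_def tensor_simps dform_simps dtensor_simps algebra_simps add_divide_distrib
      diff_divide_distrib)

lemma polynomial_dtensor: "polynomial_function (\<lambda>\<xi>. dg \<xi> \<xi> v)"
proof -
  have "bilinear (\<lambda>z u. dg z u v)"
    by (auto simp: bilinear_def intro!: linearI simp: dtensor_simps)
  then show ?thesis
    using polynomial_function_bilinear[OF _ polynomial_function_id polynomial_function_id] by blast
qed

lemma polynomial_form: "polynomial_function \<omega>"
  using polynomial_function_linear_comp[OF linear_form polynomial_function_id] .

lemma polynomial_curl: "polynomial_function (\<lambda>\<xi>. d\<omega> \<xi> v - d\<omega> v \<xi>)"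
  by (intro polynomial_function_diff polynomial_function_bilinear[OF bilinear_dform]
      polynomial_function_const polynomial_function_id)

lemma polynomial_force: "polynomial_function (\<lambda>\<xi>. force \<omega> d\<omega> g dg \<xi> v)"
  unfolding force_def divide_inverse
  by (intro polynomial_function_intros polynomial_form polynomial_dtensor polynomial_curl
      polynomial_function_bilinear[OF bilinear_tensor]
      polynomial_function_bilinear[OF bilinear_dform]
      polynomial_function_bilinear[OF bilinear_dtensor])

text \<open>With P the projection to ker \<omega> along \<open>e\<close>, the form g(Pu,Pv) +
  \<omega>(u) \<omega>(v) is nondegenerate on the whole space. One linear inverse
  \<open>\<Psi>\<close>, independent of \<xi>, then solves the system for all \<xi>, and the
  solution is polynomial because it depends linearly on \<open>F \<xi>\<close>.\<close>

lemma solve_on_kernel: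
  assumes lin: "\<And>\<xi>. linear (F \<xi>)"
    and pol: "\<And>v. polynomial_function (\<lambda>\<xi>::'a. F \<xi> v)"
  obtains S where "polynomial_function S" and "\<And>\<xi>. \<omega> (S \<xi>) = 0"
    and "\<And>\<xi> v. \<omega> v = 0 \<Longrightarrow> g (S \<xi>) v = F \<xi> v"
proof -
  obtain e where e: "\<omega> e = 1" by (rule exists_unit)
  let ?P = "kernel_proj \<omega> e"
  note P = kernel_proj[OF linear_form e]
  define \<Phi> where "\<Phi> u = (\<Sum>b\<in>Basis. (g (?P u) (?P b) + \<omega> u * \<omega> b) *\<^sub>R b)" for u
  have lin\<Phi>: "linear \<Phi>"
    unfolding \<Phi>_def
    by (rule linearI)
      (simp_all add: linear_add[OF P(1)] linear_cmul[OF P(1)] tensor_simps form_simps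
        algebra_simps sum.distrib scaleR_sum_right)
  have inner: "(\<Sum>b\<in>Basis. f b *\<^sub>R b) \<bullet> v = f v" if "linear f" for f :: "'a \<Rightarrow> real" and v
    using linear_expand[OF that, of v]
    by (simp add: inner_sum_left inner_commute[of v] mult.commute)
  have \<Phi>: "\<Phi> u \<bullet> v = g (?P u) (?P v) + \<omega> u * \<omega> v" for u v
    unfolding \<Phi>_def
    by (rule inner, rule linearI)
      (simp_all add: linear_add[OF P(1)] linear_cmul[OF P(1)] tensor_simps form_simps
        algebra_simps)
  have "u = 0" if "\<Phi> u = 0" for u
  proof (rule nondegenerate)
    \<comment> \<open>Since Pe = 0, testing \<open>\<Phi> u\<close> against \<open>e\<close>
      isolates \<omega>(u).\<close>
    show u: "\<omega> u = 0"
      using \<Phi>[of u e] that e by (simp add: kernel_proj_def tensor_simps)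
    show "g u v = 0" if "\<omega> v = 0" for v
      using \<Phi>[of u v] u that \<open>\<Phi> u = 0\<close> by (simp add: P(3))
  qed
  then have "inj \<Phi>"
    by (simp add: linear_injective_0[OF lin\<Phi>])
  then obtain \<Psi> where \<Psi>: "linear \<Psi>" "\<And>x. \<Phi> (\<Psi> x) = x"
    using linear_injective_isomorphism[OF lin\<Phi>] by blast
  define S where "S \<xi> = ?P (\<Psi> (\<Sum>b\<in>Basis. F \<xi> (?P b) *\<^sub>R b))" for \<xi>
  show thesis
  proof
    show "polynomial_function S"
      unfolding S_def
      by (intro polynomial_function_linear_comp[OF P(1)] polynomial_function_linear_comp[OF \<Psi>(1)]
          polynomial_function_sum polynomial_function_mult pol polynomial_function_const finite_Basis)
    show "\<omega> (S \<xi>) = 0" for \<xi>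
      by (simp add: S_def P)
    show "g (S \<xi>) v = F \<xi> v" if "\<omega> v = 0" for \<xi> v
    proof -
      have "linear (\<lambda>v. F \<xi> (?P v))"
        using linear_compose[OF P(1) lin] by (simp add: o_def)
      from inner[OF this, of v] have "\<Phi> (\<Psi> (\<Sum>b\<in>Basis. F \<xi> (?P b) *\<^sub>R b)) \<bullet> v = F \<xi> v"
        using that by (simp add: \<Psi> P)
      then show ?thesis
        using that by (simp add: S_def \<Phi> P)
    qed
  qed
qed

text \<open>Polarization: if the quadratic form vanished on ker \<omega>, so would the symmetric
  form, against nondegeneracy at \<open>u\<close>.\<close>

lemma nonisotropic_vector:
  assumes "\<omega> u = 0" and "u \<noteq> 0"
  obtains \<eta> where "\<omega> \<eta> = 0" and "g \<eta> \<eta> \<noteq> 0"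
proof (rule ccontr)
  assume "\<not> thesis"
  then have zero: "g \<eta> \<eta> = 0" if "\<omega> \<eta> = 0" for \<eta>
    using that \<open>\<And>\<eta>. \<omega> \<eta> = 0 \<Longrightarrow> g \<eta> \<eta> \<noteq> 0 \<Longrightarrow> thesis\<close> by blast
  have "g u v = 0" if "\<omega> v = 0" for v
    using zero[of "u + v"] zero[of u] zero[of v] sym[of v u] that assms(1)
    by (simp add: form_simps tensor_simps)
  then show False
    using nondegenerate assms by blast
qed

text \<open>A polynomial on \<open>ker \<omega>\<close> is a polynomial on the whole space after composition with a
  projection.\<close>

lemma kernel_mult_eq_0:
  assumes f: "polynomial_function f" and h: "polynomial_function h"
    and zero: "\<And>\<xi>. \<omega> \<xi> = 0 \<Longrightarrow> f \<xi> * h \<xi> = (0::real)"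
    and \<eta>: "\<omega> \<eta> = 0" "f \<eta> \<noteq> 0" and \<xi>: "\<omega> \<xi> = 0"
  shows "h \<xi> = 0"
proof -
  obtain e where e: "\<omega> e = 1" by (rule exists_unit)
  let ?P = "kernel_proj \<omega> e"
  note P = kernel_proj[OF linear_form e] and pP = polynomial_function_kernel_proj[OF linear_form e]
  have "h (?P \<xi>) = 0"
    by (rule polynomial_function_mult_eq_0[OF polynomial_function_comp[OF pP f]
          polynomial_function_comp[OF pP h], of \<eta>])
      (simp_all add: zero P \<eta>)
  then show ?thesis
    using \<xi> P by simp
qed

lemma geodesic_2jet_solution:
  assumes S: "\<omega> S = 0" "\<And>v. \<omega> v = 0 \<Longrightarrow> g S v = force \<omega> d\<omega> g dg \<xi> v"
    and a: "geodesic_2jet \<omega> d\<omega> g dg \<xi> a"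
  shows "S = \<omega> \<xi> *\<^sub>R a - \<omega> a *\<^sub>R \<xi>"
  using S a
  by (intro kernel_eqI) (simp_all add: geodesic_2jet_def form_simps tensor_simps)

text \<open>The derivatives of \<open>g\<close> carry the factor \<omega>(\<xi>) and disappear on
  the kernel, so the comparisons there involve only \<open>g\<close> and the derivative of
  \<omega>.\<close>

lemma force_kernel:
  assumes "\<omega> \<xi> = 0"
  shows "force \<omega> d\<omega> g dg \<xi> v = g \<xi> v * d\<omega> \<xi> \<xi> + g \<xi> \<xi> * (d\<omega> \<xi> v - d\<omega> v \<xi>) / 2"
  using assms by (simp add: force_def)

text \<open>\<open>l\<^sup>2 a + m \<xi>\<close> is the acceleration after a reparameterization with first and second derivatives
  \<open>l\<close> and \<open>m\<close>.\<close>

lemma geodesic_2jet_reparam: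
  assumes "geodesic_2jet \<omega> d\<omega> g dg (l *\<^sub>R \<xi>) (l\<^sup>2 *\<^sub>R a + m *\<^sub>R \<xi>)" and "l \<noteq> 0"
  shows "geodesic_2jet \<omega> d\<omega> g dg \<xi> a"
  unfolding geodesic_2jet_def
proof (intro allI impI)
  fix v assume v: "\<omega> v = 0"
  \<comment> \<open>The force is homogeneous of degree 3 in \<xi>; the left-hand side scales in the
    same way, and \<open>m\<close> cancels from it.\<close>
  have "force \<omega> d\<omega> g dg (l *\<^sub>R \<xi>) v = l ^ 3 * force \<omega> d\<omega> g dg \<xi> v"
    by (simp add: force_def tensor_simps dform_simps dtensor_simps form_simps power3_eq_cube
        power2_eq_square algebra_simps add_divide_distrib diff_divide_distrib)
  moreover have "\<omega> (l *\<^sub>R \<xi>) * g (l\<^sup>2 *\<^sub>R a + m *\<^sub>R \<xi>) v - \<omega> (l\<^sup>2 *\<^sub>R a + m *\<^sub>R \<xi>) * g (l *\<^sub>R \<xi>) v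
    = l ^ 3 * (\<omega> \<xi> * g a v - \<omega> a * g \<xi> v)"
    by (simp add: tensor_simps form_simps power3_eq_cube power2_eq_square algebra_simps)
  ultimately have "l ^ 3 * (\<omega> \<xi> * g a v - \<omega> a * g \<xi> v) = l ^ 3 * force \<omega> d\<omega> g dg \<xi> v"
    using assms v unfolding geodesic_2jet_def by metis
  then show "\<omega> \<xi> * g a v - \<omega> a * g \<xi> v = force \<omega> d\<omega> g dg \<xi> v"
    using assms by simp
qed

text \<open>Here \<open>dc\<close> stands for dC and \<open>\<theta>\<close> for d\<beta> at the
  point. After cancelling \<omega>(\<xi>), the choice \<xi> = v in the kernel gives dC(v) g(v,v) =
  0, so dC is a multiple of \<omega>. A second cancellation of \<omega>(\<xi>) leaves 2 dC(e)
  g(\<xi>,v) + \<theta>(\<xi>,v) = 0: the first term is symmetric and the second skew on the kernel,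
  so both vanish.\<close>

lemma dform_eq_0_of_conformal_perturbation:
  assumes u: "\<omega> u = 0" "u \<noteq> 0"
    and dc: "linear dc" and \<theta>: "bilinear \<theta>" "\<And>\<xi> v. \<theta> v \<xi> = - \<theta> \<xi> v"
    and W: "open W" "W \<noteq> {}"
    and eq: "\<And>\<xi> v. \<xi> \<in> W \<Longrightarrow> \<omega> v = 0 \<Longrightarrow>
      \<omega> \<xi> * (2 * dc \<xi> * g \<xi> v - dc v * g \<xi> \<xi> + \<omega> \<xi> * \<theta> \<xi> v) = 0"
  shows "dc x = 0" and "\<theta> x y = 0"
proof -
  obtain e where e: "\<omega> e = 1" by (rule exists_unit)
  note P = kernel_proj[OF linear_form e]
  obtain \<eta> where \<eta>: "\<omega> \<eta> = 0" "g \<eta> \<eta> \<noteq> 0"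
    using nonisotropic_vector[OF u] .
  have pol_dc: "polynomial_function dc"
    using polynomial_function_linear_comp[OF dc polynomial_function_id] .
  note pol = polynomial_function_intros polynomial_form pol_dc
      polynomial_function_bilinear[OF bilinear_tensor] polynomial_function_bilinear[OF \<theta>(1)]
  have eq0: "2 * dc \<xi> * g \<xi> v - dc v * g \<xi> \<xi> + \<omega> \<xi> * \<theta> \<xi> v = 0" if v: "\<omega> v = 0" for \<xi> v
  proof (rule polynomial_function_mult_eq_0[OF polynomial_form, of
        "\<lambda>\<xi>. 2 * dc \<xi> * g \<xi> v - dc v * g \<xi> \<xi> + \<omega> \<xi> * \<theta> \<xi> v" e])
    show "polynomial_function (\<lambda>\<xi>. 2 * dc \<xi> * g \<xi> v - dc v * g \<xi> \<xi> + \<omega> \<xi> * \<theta> \<xi> v)"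
      by (intro pol)
    show "\<omega> \<xi> * (2 * dc \<xi> * g \<xi> v - dc v * g \<xi> \<xi> + \<omega> \<xi> * \<theta> \<xi> v) = 0" for \<xi>
      by (rule polynomial_function_zero_on_open[where y = \<xi>, OF _ W, of
            "\<lambda>\<xi>. \<omega> \<xi> * (2 * dc \<xi> * g \<xi> v - dc v * g \<xi> \<xi> + \<omega> \<xi> * \<theta> \<xi> v)"])
        (intro pol, simp add: eq v)
  qed (simp add: e)
  have "g v v * dc v = 0" if "\<omega> v = 0" for v
    using eq0[OF that, of v] that by auto
  then have dc0: "dc v = 0" if "\<omega> v = 0" for v
    by (rule kernel_mult_eq_0[OF _ pol_dc, rotated]) (use \<eta> that in \<open>auto intro!: pol\<close>)
  have dc_eq: "dc \<xi> = \<omega> \<xi> * dc e" for \<xi>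
    using dc0[OF P(2), of \<xi>] by (simp add: kernel_proj_def linear_diff[OF dc] linear_cmul[OF dc])
  have eq1: "2 * dc e * g \<xi> v + \<theta> \<xi> v = 0" if v: "\<omega> v = 0" for \<xi> v
  proof (rule polynomial_function_mult_eq_0[OF polynomial_form, of
        "\<lambda>\<xi>. 2 * dc e * g \<xi> v + \<theta> \<xi> v" e])
    show "polynomial_function (\<lambda>\<xi>. 2 * dc e * g \<xi> v + \<theta> \<xi> v)"
      by (intro pol)
    show "\<omega> \<xi> * (2 * dc e * g \<xi> v + \<theta> \<xi> v) = 0" for \<xi>
      using eq0[OF v, of \<xi>] dc0[OF v] dc_eq[of \<xi>] by (simp add: algebra_simps)
  qed (simp add: e)
  have "dc e = 0"
    using eq1[OF \<eta>(1), of \<eta>] \<theta>(2)[of \<eta> \<eta>] \<eta>(2) by simp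
  then show "dc x = 0"
    using dc_eq[of x] by simp
  have \<theta>0: "\<theta> \<xi> v = 0" if "\<omega> v = 0" for \<xi> v
    using eq1[OF that] \<open>dc e = 0\<close> by simp
  \<comment> \<open>So far \<theta> vanishes if its second argument lies in the kernel; skew
    symmetry reduces the remaining values to \<theta>(e,e) = 0.\<close>
  have "\<theta> x y = \<omega> y * \<theta> x e"
    using \<theta>0[OF P(2), of x y]
    by (simp add: kernel_proj_def bilinear_rsub[OF \<theta>(1)] bilinear_rmul[OF \<theta>(1)])
  also have "\<theta> x e = - \<theta> e x"
    by (rule \<theta>(2))
  also have "\<theta> e x = \<omega> x * \<theta> e e"
    using \<theta>0[OF P(2), of e x]
    by (simp add: kernel_proj_def bilinear_rsub[OF \<theta>(1)] bilinear_rmul[OF \<theta>(1)])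
  also have "\<theta> e e = 0"
    using \<theta>(2)[of e e] by simp
  finally show "\<theta> x y = 0"
    by simp
qed

end

section \<open>Comparison of two metrics at one point\<close>

text \<open>The geodesic equations of \<open>g/\<omega>\<close> determine the acceleration up to multiples of \<open>\<xi>\<close> as a
  rational function of \<open>\<xi>\<close> with denominator \<open>\<omega>(\<xi>)\<close>. Comparing poles along \<open>ker \<omega>\<close> shows that
  the two kernels agree unless \<open>d\<omega>\<close> vanishes on \<open>ker \<omega>\<close>.\<close>

lemma kernel_subset_if_common_geodesics:
  assumes J: "kropina_1jet \<omega> d\<omega> g dg" and Jh: "kropina_1jet \<omega>h d\<omega>h gh dgh"
    and W: "open W" "W \<noteq> {}"
    and geo: "\<And>\<xi>. \<xi> \<in> W \<Longrightarrow>
      \<exists>a. geodesic_2jet \<omega> d\<omega> g dg \<xi> a \<and> geodesic_2jet \<omega>h d\<omega>h gh dgh \<xi> a"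
    and uv: "\<omega> u = 0" "\<omega> v = 0" "d\<omega> u v \<noteq> d\<omega> v u"
    and z: "\<omega> z = 0"
  shows "\<omega>h z = 0"
proof (rule ccontr)
  assume z': "\<omega>h z \<noteq> 0"
  interpret J: kropina_1jet \<omega> d\<omega> g dg by fact
  interpret Jh: kropina_1jet \<omega>h d\<omega>h gh dgh by fact
  obtain S where S: "polynomial_function S" "\<And>\<xi>. \<omega> (S \<xi>) = 0"
      "\<And>\<xi> v. \<omega> v = 0 \<Longrightarrow> g (S \<xi>) v = force \<omega> d\<omega> g dg \<xi> v"
    using J.solve_on_kernel[OF J.linear_force J.polynomial_force] by blast
  obtain Sh where Sh: "polynomial_function Sh" "\<And>\<xi>. \<omega>h (Sh \<xi>) = 0"
      "\<And>\<xi> v. \<omega>h v = 0 \<Longrightarrow> gh (Sh \<xi>) v = force \<omega>h d\<omega>h gh dgh \<xi> v"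
    using Jh.solve_on_kernel[OF Jh.linear_force Jh.polynomial_force] by blast
  \<comment> \<open>The combination from which the common acceleration drops out: for \<xi> in
    \<open>W\<close> it is a multiple of \<xi>.\<close>
  define B where "B \<xi> = \<omega>h \<xi> *\<^sub>R S \<xi> - \<omega> \<xi> *\<^sub>R Sh \<xi>" for \<xi>
  have pol_B: "polynomial_function B"
    unfolding B_def
    by (intro polynomial_function_intros J.polynomial_form Jh.polynomial_form S Sh)
  \<comment> \<open>Being parallel to \<xi> is written as vanishing 2x2 minors, which are polynomial
    and so extend from \<open>W\<close> to all \<xi>.\<close>
  have parallel: "(B \<xi> \<bullet> b) * (\<xi> \<bullet> b') - (B \<xi> \<bullet> b') * (\<xi> \<bullet> b) = 0" for \<xi> b b'
  proof (rule polynomial_function_zero_on_open[where y = \<xi>, OF _ W, of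
        "\<lambda>\<xi>. (B \<xi> \<bullet> b) * (\<xi> \<bullet> b') - (B \<xi> \<bullet> b') * (\<xi> \<bullet> b)"])
    show "polynomial_function (\<lambda>\<xi>. (B \<xi> \<bullet> b) * (\<xi> \<bullet> b') - (B \<xi> \<bullet> b') * (\<xi> \<bullet> b))"
      by (intro polynomial_function_intros pol_B)
    fix \<xi> assume "\<xi> \<in> W"
    then obtain a where a: "geodesic_2jet \<omega> d\<omega> g dg \<xi> a" "geodesic_2jet \<omega>h d\<omega>h gh dgh \<xi> a"
      using geo by blast
    have SSh: "S \<xi> = \<omega> \<xi> *\<^sub>R a - \<omega> a *\<^sub>R \<xi>" "Sh \<xi> = \<omega>h \<xi> *\<^sub>R a - \<omega>h a *\<^sub>R \<xi>"
      using J.geodesic_2jet_solution[OF S(2,3) a(1)] Jh.geodesic_2jet_solution[OF Sh(2,3) a(2)]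
      by auto
    have "B \<xi> = (\<omega> \<xi> * \<omega>h a - \<omega>h \<xi> * \<omega> a) *\<^sub>R \<xi>"
      unfolding B_def SSh by (simp add: algebra_simps)
    then show "(B \<xi> \<bullet> b) * (\<xi> \<bullet> b') - (B \<xi> \<bullet> b') * (\<xi> \<bullet> b) = 0"
      by simp
  qed
  \<comment> \<open>On ker \<omega> the second term of \<open>B\<close> is zero; the remaining
    factor \<open>\<omega>h\<close> is not identically zero there, by the vector \<open>z\<close>,
    and cancels.\<close>
  have S_parallel: "(S \<xi> \<bullet> b) * (\<xi> \<bullet> b') - (S \<xi> \<bullet> b') * (\<xi> \<bullet> b) = 0" if \<xi>: "\<omega> \<xi> = 0" for \<xi> b b'
  proof (rule J.kernel_mult_eq_0[OF Jh.polynomial_form _ _ z z' \<xi>])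
    show "polynomial_function (\<lambda>\<xi>. (S \<xi> \<bullet> b) * (\<xi> \<bullet> b') - (S \<xi> \<bullet> b') * (\<xi> \<bullet> b))"
      by (intro polynomial_function_intros S)
    show "\<omega>h \<xi> * ((S \<xi> \<bullet> b) * (\<xi> \<bullet> b') - (S \<xi> \<bullet> b') * (\<xi> \<bullet> b)) = 0" if "\<omega> \<xi> = 0" for \<xi>
      using parallel[of \<xi> b b'] that by (simp add: B_def algebra_simps)
  qed
  have zero: "g \<xi> \<xi> * (d\<omega> \<xi> v - d\<omega> v \<xi>) = 0" if \<xi>: "\<omega> \<xi> = 0" for \<xi>
  proof (cases "\<xi> = 0 \<or> g \<xi> \<xi> = 0")
    case True
    then show ?thesis
      by (auto simp: J.tensor_simps)
  next
    case False
    \<comment> \<open>S(\<xi>) = (m/n) \<xi>. Pairing with \<xi> itself shows m/n to be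
      d\<omega>(\<xi>,\<xi>), because the skew part of d\<omega> vanishes on equal arguments;
      pairing with \<open>v\<close> then leaves only the skew term.\<close>
    define m n where "m = S \<xi> \<bullet> \<xi>" and "n = \<xi> \<bullet> \<xi>"
    have n: "n \<noteq> 0" using False by (simp add: n_def)
    have "n *\<^sub>R S \<xi> = m *\<^sub>R \<xi>"
    proof (rule euclidean_eqI)
      fix b :: 'a
      show "(n *\<^sub>R S \<xi>) \<bullet> b = (m *\<^sub>R \<xi>) \<bullet> b"
        using S_parallel[OF \<xi>, of b \<xi>] by (simp add: m_def n_def mult.commute)
    qed
    then have "g (n *\<^sub>R S \<xi>) w = g (m *\<^sub>R \<xi>) w" for w
      by simp
    then have "n * g (S \<xi>) w = m * g \<xi> w" for w
      by (simp only: J.tensor_simps real_scaleR_def)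
    then have *: "n * (g \<xi> w * d\<omega> \<xi> \<xi> + g \<xi> \<xi> * (d\<omega> \<xi> w - d\<omega> w \<xi>) / 2) = m * g \<xi> w"
      if "\<omega> w = 0" for w
      using that S(3)[OF that, of \<xi>] J.force_kernel[OF \<xi>] by metis
    have "m = n * d\<omega> \<xi> \<xi>"
      using *[OF \<xi>] False by simp
    with *[OF uv(2)] n show ?thesis
      by (simp add: algebra_simps)
  qed
  obtain \<eta> where \<eta>: "\<omega> \<eta> = 0" "g \<eta> \<eta> \<noteq> 0"
  proof -
    have "u \<noteq> 0"
      using uv(3) J.dform_simps(5,6)[of 0 0 v] J.dform_simps(6)[of v 0 0] by auto
    then show thesis
      using J.nonisotropic_vector[OF uv(1)] that by blast
  qed
  have "d\<omega> u v - d\<omega> v u = 0"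
    by (rule J.kernel_mult_eq_0[OF _ J.polynomial_curl zero \<eta> uv(1)])
      (intro polynomial_function_bilinear[OF J.bilinear_tensor] polynomial_function_id)
  with uv(3) show False
    by simp
qed

text \<open>With the same \<omega>, the vector \<omega>(\<xi>) a - \<omega>(a) \<xi> is the same for
  both metrics, so the polynomial solution for \<open>g\<close> must also satisfy the equation for
  \<open>gh\<close>. The factor \<open>c\<close> is the ratio of the two quadratic forms, shown
  constant on the kernel.\<close>

lemma conformal_on_kernel_if_common_geodesics:
  assumes J: "kropina_1jet \<omega> d\<omega> g dg" and Jh: "kropina_1jet \<omega> d\<omega> gh dgh"
    and W: "open W" "W \<noteq> {}"
    and geo: "\<And>\<xi>. \<xi> \<in> W \<Longrightarrow>
      \<exists>a. geodesic_2jet \<omega> d\<omega> g dg \<xi> a \<and> geodesic_2jet \<omega> d\<omega> gh dgh \<xi> a"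
    and uv: "\<omega> u = 0" "\<omega> v = 0" "d\<omega> u v \<noteq> d\<omega> v u"
  obtains c where "\<And>x y. \<omega> x = 0 \<Longrightarrow> \<omega> y = 0 \<Longrightarrow> gh x y = c * g x y"
proof -
  interpret J: kropina_1jet \<omega> d\<omega> g dg by fact
  interpret Jh: kropina_1jet \<omega> d\<omega> gh dgh by fact
  define \<theta> where "\<theta> \<xi> v = d\<omega> \<xi> v - d\<omega> v \<xi>" for \<xi> v
  have bil\<theta>: "bilinear \<theta>"
    by (auto simp: bilinear_def \<theta>_def J.dform_simps algebra_simps intro!: linearI)
  obtain S where S: "polynomial_function S" "\<And>\<xi>. \<omega> (S \<xi>) = 0"
      "\<And>\<xi> v. \<omega> v = 0 \<Longrightarrow> g (S \<xi>) v = force \<omega> d\<omega> g dg \<xi> v"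
    using J.solve_on_kernel[OF J.linear_force J.polynomial_force] by blast
  \<comment> \<open>\<open>R\<close> is the \<open>g\<close>-dual of the skew form
    \<open>\<theta>\<close> on the kernel; its additivity drives the argument.\<close>
  obtain R where R: "\<And>\<xi>. \<omega> (R \<xi>) = 0" "\<And>\<xi> v. \<omega> v = 0 \<Longrightarrow> g (R \<xi>) v = \<theta> \<xi> v"
  proof -
    have "linear (\<theta> \<xi>)" for \<xi>
      using bil\<theta> by (simp add: bilinear_def)
    moreover have "polynomial_function (\<lambda>\<xi>. \<theta> \<xi> v)" for v
      unfolding \<theta>_def by (rule J.polynomial_curl)
    ultimately show thesis
      by (rule J.solve_on_kernel[of \<theta>]) (rule that)
  qed
  have S_hat: "gh (S \<xi>) v - force \<omega> d\<omega> gh dgh \<xi> v = 0" if v: "\<omega> v = 0" for \<xi> v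
  proof (rule polynomial_function_zero_on_open[where y = \<xi>, OF _ W, of
        "\<lambda>\<xi>. gh (S \<xi>) v - force \<omega> d\<omega> gh dgh \<xi> v"])
    show "polynomial_function (\<lambda>\<xi>. gh (S \<xi>) v - force \<omega> d\<omega> gh dgh \<xi> v)"
      by (intro polynomial_function_intros Jh.polynomial_force S
          polynomial_function_bilinear[OF Jh.bilinear_tensor])
    fix \<xi> assume "\<xi> \<in> W"
    then obtain a where a: "geodesic_2jet \<omega> d\<omega> g dg \<xi> a" "geodesic_2jet \<omega> d\<omega> gh dgh \<xi> a"
      using geo by blast
    have "S \<xi> = \<omega> \<xi> *\<^sub>R a - \<omega> a *\<^sub>R \<xi>"
      by (rule J.geodesic_2jet_solution[OF S(2,3) a(1)])
    then show "gh (S \<xi>) v - force \<omega> d\<omega> gh dgh \<xi> v = 0"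
      using a(2) v by (simp add: geodesic_2jet_def Jh.tensor_simps)
  qed
  \<comment> \<open>On the kernel S(\<xi>) = d\<omega>(\<xi>,\<xi>) \<xi> + g(\<xi>,\<xi>)/2
    R(\<xi>). Insertion into the equation for \<open>gh\<close> cancels the first summand.\<close>
  have key: "g \<xi> \<xi> * gh (R \<xi>) v = gh \<xi> \<xi> * \<theta> \<xi> v" if \<xi>: "\<omega> \<xi> = 0" and v: "\<omega> v = 0" for \<xi> v
  proof -
    have "S \<xi> = d\<omega> \<xi> \<xi> *\<^sub>R \<xi> + (g \<xi> \<xi> / 2) *\<^sub>R R \<xi>"
      by (rule J.kernel_eqI)
        (auto simp: S R \<xi> J.form_simps J.tensor_simps J.force_kernel \<theta>_def)
    then show ?thesis
      using S_hat[OF v, of \<xi>] by (simp add: Jh.tensor_simps Jh.force_kernel[OF \<xi>] \<theta>_def)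
  qed
  have R_add: "R (\<xi> + \<eta>) = R \<xi> + R \<eta>" for \<xi> \<eta>
    by (rule J.kernel_eqI)
      (auto simp: R J.form_simps J.tensor_simps bilinear_ladd[OF bil\<theta>])
  have \<theta>_self: "\<theta> \<xi> \<xi> = 0" for \<xi> by (simp add: \<theta>_def)
  \<comment> \<open>The relation \<open>key\<close> at \<xi>, \<eta> and \<xi> + \<eta>, linked by
    additivity of \<open>R\<close>. Testing with v = \<xi> and with v = \<eta> isolates
    \<theta>(\<xi>,\<eta>); the two results share the term in gh(\<xi> + \<eta>, \<xi> + \<eta>),
    which is eliminated.\<close>
  have prod: "g (\<xi> + \<eta>) (\<xi> + \<eta>) * (\<theta> \<xi> \<eta> * (gh \<xi> \<xi> * g \<eta> \<eta> - g \<xi> \<xi> * gh \<eta> \<eta>)) = 0"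
    if \<xi>: "\<omega> \<xi> = 0" and \<eta>: "\<omega> \<eta> = 0" for \<xi> \<eta>
  proof -
    let ?Q = "g (\<xi> + \<eta>) (\<xi> + \<eta>)" and ?Qh = "gh (\<xi> + \<eta>) (\<xi> + \<eta>)"
    have *: "?Q * (g \<eta> \<eta> * (gh \<xi> \<xi> * \<theta> \<xi> v) + g \<xi> \<xi> * (gh \<eta> \<eta> * \<theta> \<eta> v))
        = ?Qh * g \<xi> \<xi> * g \<eta> \<eta> * (\<theta> \<xi> v + \<theta> \<eta> v)" if v: "\<omega> v = 0" for v
    proof -
      have "?Q * (gh (R \<xi>) v + gh (R \<eta>) v) = ?Qh * (\<theta> \<xi> v + \<theta> \<eta> v)"
        using key[of "\<xi> + \<eta>" v] \<xi> \<eta> v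
        by (simp add: J.form_simps R_add bilinear_ladd[OF bil\<theta>] Jh.tensor_simps(1)[of "R \<xi>"])
      then have "?Q * (gh (R \<xi>) v + gh (R \<eta>) v) * (g \<xi> \<xi> * g \<eta> \<eta>)
          = ?Qh * (\<theta> \<xi> v + \<theta> \<eta> v) * (g \<xi> \<xi> * g \<eta> \<eta>)"
        by simp
      moreover have "?Q * (gh (R \<xi>) v + gh (R \<eta>) v) * (g \<xi> \<xi> * g \<eta> \<eta>) =
        ?Q * (g \<eta> \<eta> * (g \<xi> \<xi> * gh (R \<xi>) v) + g \<xi> \<xi> * (g \<eta> \<eta> * gh (R \<eta>) v))"
        by (simp add: algebra_simps del: J.tensor_simps)
      ultimately show ?thesis
        unfolding key[OF \<xi> v] key[OF \<eta> v] by (simp only: mult.assoc mult.left_commute mult.commute)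
    qed
    have "\<theta> \<eta> \<xi> = - \<theta> \<xi> \<eta>"
      by (simp add: \<theta>_def)
    with *[OF \<xi>] *[OF \<eta>] show ?thesis
      by (simp add: \<theta>_self) algebra
  qed
  have uv': "\<theta> u v \<noteq> 0"
    using uv(3) by (simp add: \<theta>_def)
  then have "u \<noteq> 0"
    using bilinear_lzero[OF bil\<theta>] by auto
  then obtain \<eta> where \<eta>: "\<omega> \<eta> = 0" "g \<eta> \<eta> \<noteq> 0"
    using J.nonisotropic_vector[OF uv(1)] by blast
  note pol = polynomial_function_intros polynomial_function_bilinear[OF J.bilinear_tensor]
    polynomial_function_bilinear[OF Jh.bilinear_tensor] polynomial_function_bilinear[OF bil\<theta>]
  \<comment> \<open>For fixed \<eta> the variable \<zeta> = \<xi> + \<eta> turns the first factor of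
    \<open>prod\<close> into g(\<zeta>,\<zeta>), which can be cancelled.\<close>
  have prod2: "\<theta> \<xi> \<eta> * (gh \<xi> \<xi> * g \<eta> \<eta> - g \<xi> \<xi> * gh \<eta> \<eta>) = 0" (is "?f \<xi> \<eta> = 0")
    if \<xi>: "\<omega> \<xi> = 0" and \<eta>': "\<omega> \<eta> = 0" for \<xi> \<eta>
  proof -
    have "\<omega> (\<zeta> - \<eta>) = 0" if "\<omega> \<zeta> = 0" for \<zeta>
      using that \<eta>' by (simp add: J.form_simps)
    then have zero: "g \<zeta> \<zeta> * ?f (\<zeta> - \<eta>) \<eta> = 0" if "\<omega> \<zeta> = 0" for \<zeta>
      using prod[of "\<zeta> - \<eta>" \<eta>] that \<eta>' by simp
    obtain \<zeta> where \<zeta>: "\<omega> \<zeta> = 0" "g \<zeta> \<zeta> \<noteq> 0"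
      using J.nonisotropic_vector[OF uv(1) \<open>u \<noteq> 0\<close>] .
    have "?f ((\<xi> + \<eta>) - \<eta>) \<eta> = 0"
      by (rule J.kernel_mult_eq_0[where f = "\<lambda>\<zeta>. g \<zeta> \<zeta>" and h = "\<lambda>\<zeta>. ?f (\<zeta> - \<eta>) \<eta>",
            OF _ _ zero \<zeta>])
        (use \<xi> \<eta>' in \<open>auto intro!: pol simp: J.form_simps\<close>)
    then show ?thesis
      by simp
  qed
  \<comment> \<open>Neither g(w,w) nor \<theta>(u,w) is identically zero on the kernel, hence
    neither is their product. Such a \<open>w\<close> serves as reference vector for the ratio:
    \<theta>(\<xi>,w) is nonzero at \<xi> = u and can be cancelled.\<close>
  have "\<exists>w. \<omega> w = 0 \<and> g w w * \<theta> u w \<noteq> 0"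
  proof (rule ccontr)
    assume "\<nexists>w. \<omega> w = 0 \<and> g w w * \<theta> u w \<noteq> 0"
    then have "\<theta> u v = 0"
      by (intro J.kernel_mult_eq_0[where f = "\<lambda>w. g w w" and h = "\<theta> u", OF _ _ _ \<eta> uv(2)] pol)
        blast
    with uv' show False by simp
  qed
  then obtain w where w: "\<omega> w = 0" "g w w \<noteq> 0" "\<theta> u w \<noteq> 0"
    by auto
  have "gh \<xi> \<xi> * g w w - g \<xi> \<xi> * gh w w = 0" if \<xi>: "\<omega> \<xi> = 0" for \<xi>
    by (rule J.kernel_mult_eq_0[where f = "\<lambda>\<xi>. \<theta> \<xi> w" and
          h = "\<lambda>\<xi>. gh \<xi> \<xi> * g w w - g \<xi> \<xi> * gh w w",
          OF _ _ prod2[OF _ w(1)] uv(1) w(3) \<xi>]) (intro pol, intro pol, assumption)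
  then have diag: "gh \<xi> \<xi> = gh w w / g w w * g \<xi> \<xi>" if "\<omega> \<xi> = 0" for \<xi>
    using w(2) that by (simp add: field_simps)
  show thesis
  proof
    fix x y assume xy: "\<omega> x = 0" "\<omega> y = 0"
    have "2 * gh x y = gh (x + y) (x + y) - gh x x - gh y y"
      using Jh.sym[of x y] by (simp add: Jh.tensor_simps)
    also have "\<dots> = gh w w / g w w * (g (x + y) (x + y) - g x x - g y y)"
      using xy by (simp only: diag J.form_simps add_0 right_diff_distrib)
    also have "g (x + y) (x + y) - g x x - g y y = 2 * g x y"
      using J.sym[of x y] by (simp add: J.tensor_simps)
    finally show "gh x y = gh w w / g w w * g x y"
      using w(2) by (simp add: field_simps)
  qed
qed

section \<open>Smooth functions\<close>

lemma frechet_derivative_eq: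
  assumes "(f has_derivative D) (at x)"
  shows "frechet_derivative f (at x) = D"
  using frechet_derivative_at[OF assms] by simp

lemma frechet_has_derivative:
  assumes "f differentiable (at x)"
  shows "(f has_derivative frechet_derivative f (at x)) (at x)"
  using assms by (simp add: frechet_derivative_works)

lemma frechet_derivative_cong_open:
  assumes "open U" and "x \<in> U" and "\<And>y. y \<in> U \<Longrightarrow> f y = g y"
  shows "frechet_derivative f (at x) = frechet_derivative g (at x)"
proof -
  have "(f has_derivative D) (at x) \<longleftrightarrow> (g has_derivative D) (at x)" for D
    using has_derivative_transform_within_open[of f D x UNIV U g]
      has_derivative_transform_within_open[of g D x UNIV U f] assms by auto
  then show ?thesis
    by (simp add: frechet_derivative_def)
qed

lemma Ck_on_cong:
  assumes "open S" and "\<And>x. x \<in> S \<Longrightarrow> f x = g x" and "Ck_on k S f"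
  shows "Ck_on k S g"
  using assms
proof (induction k arbitrary: f g)
  case 0
  then show ?case by (auto cong: continuous_on_cong)
next
  case (Suc k)
  have "g differentiable (at x)" if "x \<in> S" for x
    using Suc.prems that has_derivative_transform_within_open[of f _ x UNIV S g]
    unfolding Ck_on.simps differentiable_def by blast
  moreover have "Ck_on k S (\<lambda>x. frechet_derivative g (at x) v)" for v
  proof (rule Suc.IH)
    show "frechet_derivative f (at x) v = frechet_derivative g (at x) v" if "x \<in> S" for x
      using frechet_derivative_cong_open[OF Suc.prems(1) that, of f g] Suc.prems(2) by simp
    show "Ck_on k S (\<lambda>x. frechet_derivative f (at x) v)"
      using Suc.prems(3) by simp
  qed (fact Suc.prems)
  ultimately show ?case by simp
qed

lemma Ck_on_SucI:
  assumes "open S" and "\<And>x. x \<in> S \<Longrightarrow> (f has_derivative D x) (at x)"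
    and "\<And>v. Ck_on k S (\<lambda>x. D x v)"
  shows "Ck_on (Suc k) S f"
proof -
  have "Ck_on k S (\<lambda>x. frechet_derivative f (at x) v)" for v
    by (rule Ck_on_cong[OF assms(1) _ assms(3)[of v]])
      (simp add: frechet_derivative_eq[OF assms(2)])
  then show ?thesis
    using assms(2) by (auto simp: differentiable_def)
qed

lemma Ck_on_SucD:
  assumes "Ck_on (Suc k) S f"
  shows "x \<in> S \<Longrightarrow> (f has_derivative frechet_derivative f (at x)) (at x)"
    and "Ck_on k S (\<lambda>x. frechet_derivative f (at x) v)"
  using assms by (auto simp: frechet_derivative_works)

lemma Ck_on_mono:
  assumes "Ck_on (Suc k) S f"
  shows "Ck_on k S f"
  using assms
proof (induction k arbitrary: f)
  case 0
  then show ?case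
    by (auto intro!: continuous_at_imp_continuous_on differentiable_imp_continuous_within)
next
  case (Suc k)
  then show ?case by simp
qed

lemma Ck_on_const: "open S \<Longrightarrow> Ck_on k S (\<lambda>x. c)"
proof (induction k arbitrary: c)
  case (Suc k)
  then show ?case by (intro Ck_on_SucI[where D = "\<lambda>x v. 0"]) auto
qed auto

lemma Ck_on_add:
  assumes "open S" and "Ck_on k S f" and "Ck_on k S g"
  shows "Ck_on k S (\<lambda>x. f x + g x)"
  using assms
proof (induction k arbitrary: f g)
  case 0
  then show ?case by (auto intro: continuous_on_add)
next
  case (Suc k)
  show ?case
    by (rule Ck_on_SucI[OF Suc.prems(1) has_derivative_add[OF Ck_on_SucD(1) Ck_on_SucD(1)]])
      (use Suc in \<open>auto intro: Ck_on_SucD(2)\<close>)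
qed

lemma Ck_on_mult:
  fixes f g :: "'a::euclidean_space \<Rightarrow> real"
  assumes "open S" and "Ck_on k S f" and "Ck_on k S g"
  shows "Ck_on k S (\<lambda>x. f x * g x)"
  using assms
proof (induction k arbitrary: f g)
  case 0
  then show ?case by (auto intro: continuous_on_mult)
next
  case (Suc k)
  show ?case
  proof (rule Ck_on_SucI[OF Suc.prems(1) has_derivative_mult[OF Ck_on_SucD(1) Ck_on_SucD(1)]])
    show "Ck_on k S (\<lambda>x. f x * frechet_derivative g (at x) v + frechet_derivative f (at x) v * g x)"
      for v
      using Suc.prems Ck_on_mono by (intro Ck_on_add Suc.IH Ck_on_SucD(2)) blast+
  qed (use Suc.prems in auto)
qed

text \<open>The derivative of 1/f contains 1/f itself, but only one order lower has to be known, so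
  the induction closes.\<close>

lemma Ck_on_inverse:
  fixes f :: "'a::euclidean_space \<Rightarrow> real"
  assumes "open S" and "Ck_on k S f" and "\<And>x. x \<in> S \<Longrightarrow> f x \<noteq> 0"
  shows "Ck_on k S (\<lambda>x. inverse (f x))"
  using assms
proof (induction k arbitrary: f)
  case 0
  then show ?case by (auto intro: continuous_on_inverse)
next
  case (Suc k)
  let ?D = "\<lambda>x v. - 1 * (inverse (f x) * frechet_derivative f (at x) v * inverse (f x))"
  show ?case
  proof (rule Ck_on_SucI[OF Suc.prems(1), where D = ?D])
    show "((\<lambda>x. inverse (f x)) has_derivative ?D x) (at x)" if "x \<in> S" for x
      using Deriv.has_derivative_inverse[OF Suc.prems(3)[OF that] Ck_on_SucD(1)[OF Suc.prems(2) that]]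
      by simp
    show "Ck_on k S (\<lambda>x. ?D x v)" for v
      using Suc.prems Ck_on_mono
      by (intro Ck_on_mult Ck_on_const Suc.IH Ck_on_SucD(2)) blast+
  qed
qed

lemma smooth_on_const: "open S \<Longrightarrow> smooth_on S (\<lambda>x. c)"
  by (simp add: smooth_on_def Ck_on_const)

lemma smooth_on_add:
  "open S \<Longrightarrow> smooth_on S f \<Longrightarrow> smooth_on S g \<Longrightarrow> smooth_on S (\<lambda>x. f x + g x)"
  by (simp add: smooth_on_def Ck_on_add)

lemma smooth_on_mult:
  fixes f g :: "'a::euclidean_space \<Rightarrow> real"
  shows "open S \<Longrightarrow> smooth_on S f \<Longrightarrow> smooth_on S g \<Longrightarrow> smooth_on S (\<lambda>x. f x * g x)"
  by (simp add: smooth_on_def Ck_on_mult)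

lemma smooth_on_diff:
  fixes f g :: "'a::euclidean_space \<Rightarrow> real"
  assumes "open S" and "smooth_on S f" and "smooth_on S g"
  shows "smooth_on S (\<lambda>x. f x - g x)"
  using smooth_on_add[OF assms(1,2) smooth_on_mult[OF assms(1) smooth_on_const[OF assms(1)] assms(3)],
      of "-1"] by simp

lemma smooth_on_divide:
  fixes f g :: "'a::euclidean_space \<Rightarrow> real"
  shows "open S \<Longrightarrow> smooth_on S f \<Longrightarrow> smooth_on S g \<Longrightarrow> (\<And>x. x \<in> S \<Longrightarrow> g x \<noteq> 0) \<Longrightarrow>
    smooth_on S (\<lambda>x. f x / g x)"
  by (simp add: smooth_on_def divide_inverse Ck_on_mult Ck_on_inverse)

lemma smooth_on_sum:
  assumes "open S" and "\<And>i. i \<in> I \<Longrightarrow> smooth_on S (\<lambda>x. f x i)"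
  shows "smooth_on S (\<lambda>x. sum (f x) I)"
  using assms
  by (induction I rule: infinite_finite_induct) (auto intro: smooth_on_const smooth_on_add)

lemmas smooth_on_intros =
  smooth_on_const smooth_on_add smooth_on_diff smooth_on_mult smooth_on_sum

lemma smooth_on_cong:
  "open S \<Longrightarrow> (\<And>x. x \<in> S \<Longrightarrow> f x = g x) \<Longrightarrow> smooth_on S f \<Longrightarrow> smooth_on S g"
  unfolding smooth_on_def using Ck_on_cong by blast

lemma smooth_on_differentiable: "smooth_on S f \<Longrightarrow> x \<in> S \<Longrightarrow> f differentiable (at x)"
  unfolding smooth_on_def by (metis Ck_on.simps(2))

lemma smooth_on_continuous: "smooth_on S f \<Longrightarrow> continuous_on S f"
  unfolding smooth_on_def by (metis Ck_on.simps(1))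

lemma smooth_on_vector_derivatives:
  fixes X :: "real \<Rightarrow> 'a::real_normed_vector"
  assumes "open T" and "smooth_on T X" and "t \<in> T"
  shows "(X has_vector_derivative vector_derivative X (at t)) (at t)"
    and "\<exists>a. ((\<lambda>s. vector_derivative X (at s)) has_vector_derivative a) (at t)"
proof -
  have 1: "(X has_vector_derivative vector_derivative X (at s)) (at s)" if "s \<in> T" for s
    using smooth_on_differentiable[OF assms(2) that] by (simp add: vector_derivative_works[symmetric])
  then show "(X has_vector_derivative vector_derivative X (at t)) (at t)"
    using assms(3) .
  have "Ck_on (Suc (Suc 0)) T X"
    using assms(2) by (simp only: smooth_on_def)
  then have "(\<lambda>s. frechet_derivative X (at s) 1) differentiable (at t)"
    using assms(3) by simp
  moreover have "frechet_derivative X (at s) 1 = vector_derivative X (at s)" if "s \<in> T" for s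
    using frechet_derivative_eq[OF 1[OF that, unfolded has_vector_derivative_def]] by simp
  ultimately have "(\<lambda>s. vector_derivative X (at s)) differentiable (at t)"
    using has_derivative_transform_within_open[OF _ assms(1,3), of "\<lambda>s. frechet_derivative X (at s) 1"
        _ UNIV "\<lambda>s. vector_derivative X (at s)"]
    unfolding differentiable_def by blast
  then show "\<exists>a. ((\<lambda>s. vector_derivative X (at s)) has_vector_derivative a) (at t)"
    using vector_derivative_works by blast
qed

section \<open>Kropina metrics in coordinates\<close>

definition form_deriv :: "('a::real_normed_vector \<Rightarrow> 'a \<Rightarrow> real) \<Rightarrow> 'a \<Rightarrow> 'a \<Rightarrow> 'a \<Rightarrow> real"
  where "form_deriv w x z v = frechet_derivative (\<lambda>y. w y v) (at x) z"

definition tensor_deriv ::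
  "('a::real_normed_vector \<Rightarrow> 'a \<Rightarrow> 'a \<Rightarrow> real) \<Rightarrow> 'a \<Rightarrow> 'a \<Rightarrow> 'a \<Rightarrow> 'a \<Rightarrow> real"
  where "tensor_deriv G x z u v = frechet_derivative (\<lambda>y. G y u v) (at x) z"

lemma bilinear_form_deriv:
  fixes w :: "'a::euclidean_space \<Rightarrow> 'a \<Rightarrow> real"
  assumes U: "open U" "x \<in> U" and lin: "\<And>y. y \<in> U \<Longrightarrow> linear (w y)"
    and diff: "\<And>v. (\<lambda>y. w y v) differentiable (at x)"
  shows "bilinear (form_deriv w x)"
proof -
  note D = frechet_has_derivative[OF diff]
  have "form_deriv w x z (u + v) = form_deriv w x z u + form_deriv w x z v" for z u v
  proof -
    have "((\<lambda>y. w y (u + v)) has_derivative (\<lambda>z. form_deriv w x z u + form_deriv w x z v)) (at x)"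
      unfolding form_deriv_def
      by (rule has_derivative_transform_within_open[OF has_derivative_add[OF D[of u] D[of v]] U])
        (simp add: linear_add[OF lin])
    then show ?thesis
      unfolding form_deriv_def by (simp add: frechet_derivative_eq)
  qed
  moreover have "form_deriv w x z (r *\<^sub>R v) = r *\<^sub>R form_deriv w x z v" for z r v
  proof -
    have "((\<lambda>y. w y (r *\<^sub>R v)) has_derivative (\<lambda>z. r *\<^sub>R form_deriv w x z v)) (at x)"
      unfolding form_deriv_def
      by (rule has_derivative_transform_within_open[OF has_derivative_scaleR_right[OF D[of v]] U])
        (simp add: linear_cmul[OF lin])
    then show ?thesis
      unfolding form_deriv_def by (simp add: frechet_derivative_eq)
  qed
  moreover have "linear (\<lambda>z. form_deriv w x z v)" for v
    unfolding form_deriv_def using linear_frechet_derivative[OF diff] .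
  ultimately show ?thesis
    by (auto simp: bilinear_def intro!: linearI)
qed

text \<open>Differentiability of the field is available only for fixed vector arguments, so the
  moving argument is expanded in the basis and the product rule is applied to each
  coefficient.\<close>

lemma has_derivative_form_along:
  fixes w :: "'a::euclidean_space \<Rightarrow> 'a \<Rightarrow> real"
  assumes U: "open U" "X t \<in> U" and lin: "\<And>y. y \<in> U \<Longrightarrow> linear (w y)"
    and diff: "\<And>v. (\<lambda>y. w y v) differentiable (at (X t))"
    and X: "(X has_vector_derivative \<xi>) (at t)" and Y: "(Y has_vector_derivative \<eta>) (at t)"
  shows "((\<lambda>s. w (X s) (Y s)) has_real_derivative form_deriv w (X t) \<xi> (Y t) + w (X t) \<eta>) (at t)"
proof -
  have bil: "bilinear (form_deriv w (X t))"
    by (rule bilinear_form_deriv[OF U lin diff])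
  have w: "((\<lambda>s. w (X s) b) has_real_derivative form_deriv w (X t) \<xi> b) (at t)" for b
  proof -
    have "((\<lambda>s. w (X s) b) has_derivative (\<lambda>h. form_deriv w (X t) (h *\<^sub>R \<xi>) b)) (at t)"
      unfolding form_deriv_def
      using has_derivative_compose[OF X[unfolded has_vector_derivative_def] frechet_has_derivative[OF diff]] .
    then show ?thesis
      by (simp add: has_field_derivative_def bilinear_lmul[OF bil] mult.commute[of _ "form_deriv w (X t) \<xi> b"])
  qed
  have Yb: "((\<lambda>s. Y s \<bullet> b) has_real_derivative \<eta> \<bullet> b) (at t)" for b
    using has_derivative_inner_left[OF Y[unfolded has_vector_derivative_def], of b]
    by (simp add: has_field_derivative_def mult.commute[of _ "\<eta> \<bullet> b"])
  have "((\<lambda>s. \<Sum>b\<in>Basis. (Y s \<bullet> b) * w (X s) b) has_real_derivative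
      (\<Sum>b\<in>Basis. (\<eta> \<bullet> b) * w (X t) b + form_deriv w (X t) \<xi> b * (Y t \<bullet> b))) (at t)"
    by (intro DERIV_sum DERIV_mult w Yb)
  moreover have "(\<Sum>b\<in>Basis. (\<eta> \<bullet> b) * w (X t) b + form_deriv w (X t) \<xi> b * (Y t \<bullet> b))
    = form_deriv w (X t) \<xi> (Y t) + w (X t) \<eta>"
    using linear_expand[OF lin[OF U(2)], of \<eta>] bil linear_expand[of "form_deriv w (X t) \<xi>" "Y t"]
    by (simp add: bilinear_def sum.distrib mult.commute)
  ultimately have *: "((\<lambda>s. \<Sum>b\<in>Basis. (Y s \<bullet> b) * w (X s) b) has_real_derivative
      form_deriv w (X t) \<xi> (Y t) + w (X t) \<eta>) (at t)"
    by simp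
  have "isCont X t"
    using X has_vector_derivative_continuous by blast
  then obtain T where T: "open T" "t \<in> T" "\<And>s. s \<in> T \<Longrightarrow> X s \<in> U"
    using U continuous_at_open[of t X] by metis
  show ?thesis
    by (rule has_field_derivative_transform_within_open[OF * T(1,2)])
      (simp add: linear_expand[OF lin[OF T(3)], symmetric, simplified])
qed

lemma has_derivative_tensor_along:
  fixes G :: "'a::euclidean_space \<Rightarrow> 'a \<Rightarrow> 'a \<Rightarrow> real"
  assumes U: "open U" "X t \<in> U" and bil: "\<And>y. y \<in> U \<Longrightarrow> bilinear (G y)"
    and diff: "\<And>u v. (\<lambda>y. G y u v) differentiable (at (X t))"
    and X: "(X has_vector_derivative \<xi>) (at t)" and Y: "(Y has_vector_derivative \<eta>) (at t)"
    and Z: "(Z has_vector_derivative \<zeta>) (at t)"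
  shows "((\<lambda>s. G (X s) (Y s) (Z s)) has_real_derivative
    tensor_deriv G (X t) \<xi> (Y t) (Z t) + G (X t) \<eta> (Z t) + G (X t) (Y t) \<zeta>) (at t)"
proof -
  have lin: "linear (G y u)" "linear (\<lambda>u. G y u v)" if "y \<in> U" for y u v
    using bil[OF that] by (auto simp: bilinear_def)
  have Gb: "((\<lambda>s. G (X s) b (Z s)) has_real_derivative tensor_deriv G (X t) \<xi> b (Z t) + G (X t) b \<zeta>)
      (at t)" for b
    using has_derivative_form_along[where w = "\<lambda>y. G y b", OF U lin(1) diff X Z]
    by (simp add: form_deriv_def tensor_deriv_def)
  have Yb: "((\<lambda>s. Y s \<bullet> b) has_real_derivative \<eta> \<bullet> b) (at t)" for b
    using has_derivative_inner_left[OF Y[unfolded has_vector_derivative_def], of b]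
    by (simp add: has_field_derivative_def mult.commute[of _ "\<eta> \<bullet> b"])
  have "bilinear (form_deriv (\<lambda>y u. G y u v) (X t))" for v
    by (rule bilinear_form_deriv[OF U lin(2) diff])
  then have lin': "linear (\<lambda>u. tensor_deriv G (X t) \<xi> u v)" for v
    by (simp add: bilinear_def form_deriv_def tensor_deriv_def)
  have "((\<lambda>s. \<Sum>b\<in>Basis. (Y s \<bullet> b) * G (X s) b (Z s)) has_real_derivative
      (\<Sum>b\<in>Basis. (\<eta> \<bullet> b) * G (X t) b (Z t) +
        (tensor_deriv G (X t) \<xi> b (Z t) + G (X t) b \<zeta>) * (Y t \<bullet> b))) (at t)"
    by (intro DERIV_sum DERIV_mult Gb Yb)
  moreover have "(\<Sum>b\<in>Basis. (\<eta> \<bullet> b) * G (X t) b (Z t) +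
        (tensor_deriv G (X t) \<xi> b (Z t) + G (X t) b \<zeta>) * (Y t \<bullet> b)) =
     tensor_deriv G (X t) \<xi> (Y t) (Z t) + G (X t) \<eta> (Z t) + G (X t) (Y t) \<zeta>"
    using linear_expand[OF lin(2)[OF U(2)], of \<eta> "Z t"] linear_expand[OF lin(2)[OF U(2)], of "Y t" \<zeta>]
      linear_expand[OF lin', of "Y t" "Z t"]
    by (simp add: sum.distrib algebra_simps)
  ultimately have *: "((\<lambda>s. \<Sum>b\<in>Basis. (Y s \<bullet> b) * G (X s) b (Z s)) has_real_derivative
      tensor_deriv G (X t) \<xi> (Y t) (Z t) + G (X t) \<eta> (Z t) + G (X t) (Y t) \<zeta>) (at t)"
    by simp
  have "isCont X t"
    using X has_vector_derivative_continuous by blast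
  then obtain T where T: "open T" "t \<in> T" "\<And>s. s \<in> T \<Longrightarrow> X s \<in> U"
    using U continuous_at_open[of t X] by metis
  show ?thesis
    by (rule has_field_derivative_transform_within_open[OF * T(1,2)])
      (simp add: linear_expand[OF lin(2)[OF T(3)], symmetric, simplified])
qed

locale kropina_field =
  fixes U :: "'a::euclidean_space set"
    and w :: "'a \<Rightarrow> 'a \<Rightarrow> real" and G :: "'a \<Rightarrow> 'a \<Rightarrow> 'a \<Rightarrow> real"
  assumes open_domain: "open U"
    and linear_field: "\<And>y. y \<in> U \<Longrightarrow> linear (w y)"
    and bilinear_field: "\<And>y. y \<in> U \<Longrightarrow> bilinear (G y)"
    and sym_field: "\<And>y u v. y \<in> U \<Longrightarrow> G y u v = G y v u"
    and smooth_form: "\<And>v. smooth_on U (\<lambda>y. w y v)"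
    and smooth_tensor: "\<And>u v. smooth_on U (\<lambda>y. G y u v)"
    and nonzero_field: "\<And>y. y \<in> U \<Longrightarrow> \<exists>v. w y v \<noteq> 0"
    and nondegenerate_field: "\<And>y u. y \<in> U \<Longrightarrow> w y u = 0 \<Longrightarrow> (\<And>v. w y v = 0 \<Longrightarrow> G y u v = 0) \<Longrightarrow> u = 0"
begin

lemma diff_form: "y \<in> U \<Longrightarrow> (\<lambda>y. w y v) differentiable (at y)"
  using smooth_form smooth_on_differentiable by blast

lemma diff_tensor: "y \<in> U \<Longrightarrow> (\<lambda>y. G y u v) differentiable (at y)"
  using smooth_tensor smooth_on_differentiable by blast

lemma kropina_1jet:
  assumes x: "x \<in> U"
  shows "kropina_1jet (w x) (form_deriv w x) (G x) (tensor_deriv G x)"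
proof (rule kropina_1jet.intro)
  have lin: "linear (G y u)" "linear (\<lambda>u. G y u v)" if "y \<in> U" for y u v
    using bilinear_field[OF that] by (auto simp: bilinear_def)
  have 1: "bilinear (form_deriv (\<lambda>y u. G y u v) x)" for v
    by (rule bilinear_form_deriv[OF open_domain x lin(2) diff_tensor[OF x]])
  have 2: "bilinear (form_deriv (\<lambda>y. G y u) x)" for u
    by (rule bilinear_form_deriv[OF open_domain x lin(1) diff_tensor[OF x]])
  show "bilinear (tensor_deriv G x z)" for z
    using 1 2 by (auto simp: bilinear_def form_deriv_def tensor_deriv_def)
  show "linear (\<lambda>z. tensor_deriv G x z u v)" for u v
    using 1 by (auto simp: bilinear_def form_deriv_def tensor_deriv_def)
  show "bilinear (form_deriv w x)"
    by (rule bilinear_form_deriv[OF open_domain x linear_field diff_form[OF x]])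
qed (use x linear_field bilinear_field sym_field nonzero_field nondegenerate_field in auto)

text \<open>The derivative of the momentum along the curve is computed twice, by the Euler-Lagrange
  equation and by the product rule, and the results are equated. The momentum must be known near
  \<open>t\<close>, which is why \<omega> is nonzero on the velocity for all parameters in
  \<open>T\<close>.\<close>

lemma geodesic_2jet_if_euler_lagrange:
  assumes T: "open T" "t \<in> T"
    and XU: "\<And>s. s \<in> T \<Longrightarrow> X s \<in> U"
    and X: "\<And>s. s \<in> T \<Longrightarrow> (X has_vector_derivative V s) (at s)"
    and V: "(V has_vector_derivative a) (at t)"
    and nz: "\<And>s. s \<in> T \<Longrightarrow> w (X s) (V s) \<noteq> 0"
    and EL: "\<And>v. ((\<lambda>s. frechet_derivative (\<lambda>\<xi>. G (X s) \<xi> \<xi> / w (X s) \<xi>) (at (V s)) v)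
        has_real_derivative frechet_derivative (\<lambda>y. G y (V t) (V t) / w y (V t)) (at (X t)) v) (at t)"
  shows "geodesic_2jet (w (X t)) (form_deriv w (X t)) (G (X t)) (tensor_deriv G (X t)) (V t) a"
  unfolding geodesic_2jet_def
proof (intro allI impI)
  fix v assume v: "w (X t) v = 0"
  define x \<xi> where "x = X t" and "\<xi> = V t"
  have x: "x \<in> U" using XU T(2) by (simp add: x_def)
  interpret J: kropina_1jet "w x" "form_deriv w x" "G x" "tensor_deriv G x"
    by (rule kropina_1jet[OF x])
  have n: "w x \<xi> \<noteq> 0" using nz[OF T(2)] by (simp add: x_def \<xi>_def)
  \<comment> \<open>The momentum. The term with \<open>w (X s) v\<close> must be kept, since
    \<open>v\<close> lies in the kernel only at the parameter \<open>t\<close> and this term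
    contributes the derivative of \<omega>.\<close>
  have "frechet_derivative (\<lambda>\<xi>. G (X s) \<xi> \<xi> / w (X s) \<xi>) (at (V s)) v =
      2 * G (X s) (V s) v / w (X s) (V s) - G (X s) (V s) (V s) * w (X s) v / (w (X s) (V s))\<^sup>2"
    if s: "s \<in> T" for s
  proof -
    interpret Js: kropina_1jet "w (X s)" "form_deriv w (X s)" "G (X s)" "tensor_deriv G (X s)"
      by (rule kropina_1jet[OF XU[OF s]])
    have "bounded_bilinear (G (X s))"
      using Js.bilinear_tensor by (simp add: bilinear_conv_bounded_bilinear)
    from bounded_bilinear.FDERIV[OF this has_derivative_ident has_derivative_ident]
    have G: "((\<lambda>\<xi>. G (X s) \<xi> \<xi>) has_derivative (\<lambda>h. G (X s) (V s) h + G (X s) h (V s))) (at (V s))" .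
    have W: "(w (X s) has_derivative w (X s)) (at (V s))"
      using linear_imp_has_derivative[OF Js.linear_form] .
    show ?thesis
      unfolding frechet_derivative_eq[OF has_derivative_divide'[OF G W nz[OF s]]]
      using nz[OF s] Js.sym[of v "V s"] by (simp add: field_simps power2_eq_square)
  qed
  then have E1: "((\<lambda>s. 2 * G (X s) (V s) v / w (X s) (V s)
        - G (X s) (V s) (V s) * w (X s) v / (w (X s) (V s))\<^sup>2)
      has_real_derivative frechet_derivative (\<lambda>y. G y \<xi> \<xi> / w y \<xi>) (at x) v) (at t)"
    using has_field_derivative_transform_within_open[OF EL[of v] T] by (simp add: x_def \<xi>_def)
  have E2: "frechet_derivative (\<lambda>y. G y \<xi> \<xi> / w y \<xi>) (at x) v =
      (tensor_deriv G x v \<xi> \<xi> * w x \<xi> - G x \<xi> \<xi> * form_deriv w x v \<xi>) / (w x \<xi> * w x \<xi>)"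
    unfolding tensor_deriv_def form_deriv_def
      frechet_derivative_eq[OF has_derivative_divide'[OF frechet_has_derivative[OF diff_tensor[OF x]]
        frechet_has_derivative[OF diff_form[OF x]] n]]
    ..
  have Xt: "(X has_vector_derivative \<xi>) (at t)" using X[OF T(2)] by (simp add: \<xi>_def)
  have v0: "((\<lambda>s. v) has_vector_derivative 0) (at t)" by simp
  note hyps = open_domain XU[OF T(2)]
  note hypsw = hyps linear_field diff_form[OF XU[OF T(2)]] Xt
    and hypsG = hyps bilinear_field diff_tensor[OF XU[OF T(2)]] Xt
  have D1: "((\<lambda>s. w (X s) (V s)) has_real_derivative form_deriv w x \<xi> \<xi> + w x a) (at t)"
    using has_derivative_form_along[OF hypsw V] by (simp add: x_def \<xi>_def)
  have D2: "((\<lambda>s. w (X s) v) has_real_derivative form_deriv w x \<xi> v) (at t)"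
    using has_derivative_form_along[OF hypsw v0] J.form_simps(4) by (simp add: x_def \<xi>_def)
  have D3: "((\<lambda>s. G (X s) (V s) v) has_real_derivative tensor_deriv G x \<xi> \<xi> v + G x a v) (at t)"
    using has_derivative_tensor_along[OF hypsG V v0] J.tensor_simps(8) by (simp add: x_def \<xi>_def)
  \<comment> \<open>The value \<open>q\<close> may stay unknown: in the derivative of the momentum
    it is multiplied by \<omega>(v) = 0.\<close>
  obtain q where D4: "((\<lambda>s. G (X s) (V s) (V s)) has_real_derivative q) (at t)"
    using has_derivative_tensor_along[OF hypsG V V] by blast
  have E3: "((\<lambda>s. 2 * G (X s) (V s) v / w (X s) (V s)
        - G (X s) (V s) (V s) * w (X s) v / (w (X s) (V s))\<^sup>2)
      has_real_derivative
        (2 * (tensor_deriv G x \<xi> \<xi> v + G x a v) * w x \<xi> - 2 * G x \<xi> v * (form_deriv w x \<xi> \<xi> + w x a))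
          / (w x \<xi> * w x \<xi>)
        - G x \<xi> \<xi> * form_deriv w x \<xi> v / (w x \<xi>)\<^sup>2) (at t)"
    using n v
    by (auto intro!: derivative_eq_intros D1 D2 D3 D4 simp: x_def[symmetric] \<xi>_def[symmetric])
      (simp add: field_simps power2_eq_square power4_eq_xxxx)
  have "(2 * (tensor_deriv G x \<xi> \<xi> v + G x a v) * w x \<xi> - 2 * G x \<xi> v * (form_deriv w x \<xi> \<xi> + w x a))
          / (w x \<xi> * w x \<xi>) - G x \<xi> \<xi> * form_deriv w x \<xi> v / (w x \<xi>)\<^sup>2
    = (tensor_deriv G x v \<xi> \<xi> * w x \<xi> - G x \<xi> \<xi> * form_deriv w x v \<xi>) / (w x \<xi> * w x \<xi>)"
    by (rule DERIV_unique[OF E3 E1[unfolded E2]])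
  then have "2 * (tensor_deriv G x \<xi> \<xi> v + G x a v) * w x \<xi> - 2 * G x \<xi> v * (form_deriv w x \<xi> \<xi> + w x a)
      - G x \<xi> \<xi> * form_deriv w x \<xi> v
    = tensor_deriv G x v \<xi> \<xi> * w x \<xi> - G x \<xi> \<xi> * form_deriv w x v \<xi>"
    using n by (simp add: power2_eq_square diff_divide_distrib[symmetric])
  then show "w (X t) (V t) * G (X t) a v - w (X t) a * G (X t) (V t) v =
      force (w (X t)) (form_deriv w (X t)) (G (X t)) (tensor_deriv G (X t)) (V t) v"
    unfolding x_def[symmetric] \<xi>_def[symmetric] by (simp add: force_def field_simps)
qed

end

text \<open>The relation \<open>eq\<close> says that the second metric is C F + B. For test vectors
  in the kernel the contributions of \<open>B\<close> to the acceleration terms are both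
  \<omega>(\<xi>) \<omega>(a) B(v)/2 and cancel. Those terms thus differ by the factor C alone, and
  comparing forces eliminates \<open>a\<close>.\<close>

lemma kropina_perturbation:
  assumes F: "kropina_field U w G" and Fh: "kropina_field U w Gh" and x: "x \<in> U"
    and C: "C differentiable (at x)" and B: "\<And>u. (\<lambda>y. B y u) differentiable (at x)"
    and eq: "\<And>y u v. y \<in> U \<Longrightarrow> Gh y u v = C y * G y u v + (w y u * B y v + w y v * B y u) / 2"
    and geo: "geodesic_2jet (w x) (form_deriv w x) (G x) (tensor_deriv G x) \<xi> a"
      "geodesic_2jet (w x) (form_deriv w x) (Gh x) (tensor_deriv Gh x) \<xi> a"
    and v: "w x v = 0"
  shows "w x \<xi> * (2 * frechet_derivative C (at x) \<xi> * G x \<xi> v - frechet_derivative C (at x) v * G x \<xi> \<xi>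
    + w x \<xi> * (form_deriv B x \<xi> v - form_deriv B x v \<xi>)) = 0"
proof -
  interpret F: kropina_field U w G by fact
  note D = frechet_has_derivative
  have dGh: "tensor_deriv Gh x z p q = C x * tensor_deriv G x z p q + frechet_derivative C (at x) z * G x p q
    + (w x p * form_deriv B x z q + form_deriv w x z p * B x q +
       (w x q * form_deriv B x z p + form_deriv w x z q * B x p)) / 2" for z p q
  proof -
    have "((\<lambda>y. Gh y p q) has_derivative (\<lambda>z. C x * tensor_deriv G x z p q + frechet_derivative C (at x) z * G x p q
      + (w x p * form_deriv B x z q + form_deriv w x z p * B x q +
       (w x q * form_deriv B x z p + form_deriv w x z q * B x p)) / 2)) (at x)"
      unfolding form_deriv_def tensor_deriv_def
      by (rule has_derivative_transform_within_open[of
            "\<lambda>y. C y * G y p q + (w y p * B y q + w y q * B y p) / 2" _ x UNIV U])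
        (use x F.open_domain eq in \<open>auto intro!: has_derivative_add has_derivative_mult
          D C B F.diff_form F.diff_tensor bounded_linear.has_derivative[OF bounded_linear_divide]\<close>)
    then show ?thesis
      by (simp add: tensor_deriv_def frechet_derivative_eq)
  qed
  define dC where "dC = frechet_derivative C (at x)"
  have 1: "w x \<xi> * G x a v - w x a * G x \<xi> v = force (w x) (form_deriv w x) (G x) (tensor_deriv G x) \<xi> v"
    and 2: "w x \<xi> * Gh x a v - w x a * Gh x \<xi> v = force (w x) (form_deriv w x) (Gh x) (tensor_deriv Gh x) \<xi> v"
    using geo v by (auto simp: geodesic_2jet_def)
  have "w x \<xi> * Gh x a v - w x a * Gh x \<xi> v = C x * (w x \<xi> * G x a v - w x a * G x \<xi> v)"
    by (simp add: eq[OF x] v algebra_simps)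
  with 1 2 have "force (w x) (form_deriv w x) (Gh x) (tensor_deriv Gh x) \<xi> v
      - C x * force (w x) (form_deriv w x) (G x) (tensor_deriv G x) \<xi> v = 0"
    by simp
  then show ?thesis
    unfolding force_def dGh eq[OF x] v dC_def[symmetric] by (simp add: field_simps)
qed

section \<open>Charts\<close>

lemma chart_inverse:
  assumes "is_chart c"
  shows "p \<in> cdom c \<Longrightarrow> cinv c (coord c p) = p"
    and "x \<in> coord c ` cdom c \<Longrightarrow> cinv c x \<in> cdom c"
    and "x \<in> coord c ` cdom c \<Longrightarrow> coord c (cinv c x) = x"
    and "open (cdom c)" and "open (coord c ` cdom c)" and "continuous_on (cdom c) (coord c)"
  using assms unfolding is_chart_def homeomorphism_def by auto

lemma smooth_atlas_chart: "smooth_atlas A \<Longrightarrow> c \<in> A \<Longrightarrow> is_chart c"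
  by (simp add: smooth_atlas_def)

lemma smooth_atlas_cover:
  assumes "smooth_atlas A"
  obtains c where "c \<in> A" and "p \<in> cdom c"
  using assms unfolding smooth_atlas_def by blast

lemma one_formD:
  assumes "one_form A \<omega>" and "c \<in> A"
  shows "p \<in> cdom c \<Longrightarrow> linear (\<omega> c p)"
    and "smooth_on (coord c ` cdom c) (\<lambda>x. \<omega> c (cinv c x) v)"
    and "d \<in> A \<Longrightarrow> p \<in> cdom c \<Longrightarrow> p \<in> cdom d \<Longrightarrow> \<omega> d p (transfer c d p v) = \<omega> c p v"
  using assms by (auto simp: one_form_def)

lemma symmetric_two_tensorD:
  assumes "symmetric_two_tensor A g" and "c \<in> A"
  shows "p \<in> cdom c \<Longrightarrow> bilinear (g c p)" and "p \<in> cdom c \<Longrightarrow> g c p u v = g c p v u"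
    and "smooth_on (coord c ` cdom c) (\<lambda>x. g c (cinv c x) u v)"
    and "d \<in> A \<Longrightarrow> p \<in> cdom c \<Longrightarrow> p \<in> cdom d \<Longrightarrow>
      g d p (transfer c d p u) (transfer c d p v) = g c p u v"
  using assms by (auto simp: symmetric_two_tensor_def)

lemma kropina_field_chart:
  assumes "smooth_atlas A" and "kropina_pair A g \<omega>" and "nondegenerate_on_kernel A g \<omega>" and c: "c \<in> A"
  shows "kropina_field (coord c ` cdom c) (\<lambda>x. \<omega> c (cinv c x)) (\<lambda>x. g c (cinv c x))"
proof -
  note ch = chart_inverse[OF smooth_atlas_chart[OF assms(1) c]]
  have form: "one_form A \<omega>" and tensor: "symmetric_two_tensor A g"
    and nz: "\<And>p. p \<in> cdom c \<Longrightarrow> \<exists>v. \<omega> c p v \<noteq> 0"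
    using assms by (auto simp: kropina_pair_def)
  note \<omega> = one_formD[OF form c] and g = symmetric_two_tensorD[OF tensor c]
  show ?thesis
  proof (rule kropina_field.intro)
    show "u = 0" if "y \<in> coord c ` cdom c" "\<omega> c (cinv c y) u = 0"
      "\<And>v. \<omega> c (cinv c y) v = 0 \<Longrightarrow> g c (cinv c y) u v = 0" for y u
      using assms(3) c ch(2)[OF that(1)] that(2,3) unfolding nondegenerate_on_kernel_def by blast
    show "open (coord c ` cdom c)" by (rule ch)
    fix y u v
    show "smooth_on (coord c ` cdom c) (\<lambda>y. \<omega> c (cinv c y) v)" by (rule \<omega>)
    show "smooth_on (coord c ` cdom c) (\<lambda>y. g c (cinv c y) u v)" by (rule g)
    assume "y \<in> coord c ` cdom c"
    then have y: "cinv c y \<in> cdom c" by (rule ch)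
    show "linear (\<omega> c (cinv c y))" by (rule \<omega>(1)[OF y])
    show "bilinear (g c (cinv c y))" by (rule g(1)[OF y])
    show "g c (cinv c y) u v = g c (cinv c y) v u" by (rule g(2)[OF y])
    show "\<exists>v. \<omega> c (cinv c y) v \<noteq> 0" by (rule nz[OF y])
  qed
qed

lemma ext_deriv_form_deriv:
  "ext_deriv \<omega> c p u v = form_deriv (\<lambda>x. \<omega> c (cinv c x)) (coord c p) u v
     - form_deriv (\<lambda>x. \<omega> c (cinv c x)) (coord c p) v u"
  by (simp add: ext_deriv_def form_deriv_def)

text \<open>The second derivative \<open>a\<close> of the curve itself is used for both metrics, although the two
  Euler-Lagrange equations hold in different parameterizations of the curve.\<close>

lemma geodesic_2jet_if_unparameterized_geodesic:
  assumes atlas: "smooth_atlas A" and pair: "kropina_pair A g \<omega>" and nondeg: "nondegenerate_on_kernel A g \<omega>"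
    and c: "c \<in> A" and \<gamma>: "smooth_regular_curve A (I, \<gamma>)" and t: "t \<in> I" "\<gamma> t \<in> cdom c"
    and geo: "unparameterized_geodesic A g \<omega> (I, \<gamma>)"
    and a: "((\<lambda>s. velocity c \<gamma> s) has_vector_derivative a) (at t)"
  shows "geodesic_2jet (\<omega> c (\<gamma> t)) (form_deriv (\<lambda>x. \<omega> c (cinv c x)) (coord c (\<gamma> t)))
    (g c (\<gamma> t)) (tensor_deriv (\<lambda>x. g c (cinv c x)) (coord c (\<gamma> t))) (velocity c \<gamma> t) a"
proof -
  note ch = chart_inverse[OF smooth_atlas_chart[OF atlas c]]
  interpret F: kropina_field "coord c ` cdom c" "\<lambda>x. \<omega> c (cinv c x)" "\<lambda>x. g c (cinv c x)"
    by (rule kropina_field_chart[OF atlas pair nondeg c])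
  obtain J \<delta> where geo': "reparameterization (I, \<gamma>) (J, \<delta>)" "kropina_geodesic A g \<omega> (J, \<delta>)"
    using geo unfolding unparameterized_geodesic_def by auto
  obtain \<phi> where \<phi>: "bij_betw \<phi> J I" "smooth_on J \<phi>" "\<And>s. s \<in> J \<Longrightarrow> deriv \<phi> s \<noteq> 0" "\<delta> = \<gamma> \<circ> \<phi>"
    using geo'(1) by (auto simp: reparameterization_def)
  have \<delta>: "smooth_regular_curve A (J, \<delta>)" and EL: "euler_lagrange A (kropina g \<omega>) (J, \<delta>)"
    and nz: "\<And>s. s \<in> J \<Longrightarrow> \<delta> s \<in> cdom c \<Longrightarrow> \<omega> c (\<delta> s) (velocity c \<delta> s) \<noteq> 0"
    using geo'(2) c by (auto simp: kropina_geodesic_def)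
  define T where "T = {r \<in> I. \<gamma> r \<in> cdom c}"
  define T' where "T' = {r \<in> J. \<delta> r \<in> cdom c}"
  have I: "open I" "continuous_on I \<gamma>" and X: "smooth_on T (coord c \<circ> \<gamma>)"
    and J: "open J" "continuous_on J \<delta>"
    using \<gamma> \<delta> c by (auto simp: smooth_regular_curve_def T_def)
  have "open T" "open T'"
    using continuous_open_preimage[OF I(2,1) ch(4)] continuous_open_preimage[OF J(2,1) ch(4)]
    by (auto simp: T_def T'_def vimage_def Int_def)
  obtain s where s: "s \<in> J" "\<phi> s = t"
    using \<phi>(1) t(1) by (auto simp: bij_betw_def)
  have sT': "s \<in> T'"
    using s t \<phi>(4) by (simp add: T'_def)
  have \<phi>T: "\<phi> r \<in> T" if "r \<in> T'" for r
    using that \<phi>(1,4) by (auto simp: T_def T'_def bij_betw_def)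
  define \<phi>1 where "\<phi>1 r = vector_derivative \<phi> (at r)" for r
  have \<phi>1: "(\<phi> has_vector_derivative \<phi>1 r) (at r)" if "r \<in> J" for r
    using smooth_on_vector_derivatives(1)[OF J(1) \<phi>(2) that] by (simp add: \<phi>1_def)
  obtain b where b: "(\<phi>1 has_vector_derivative b) (at s)"
    using smooth_on_vector_derivatives(2)[OF J(1) \<phi>(2) s(1)] unfolding \<phi>1_def by blast
  have V: "((coord c \<circ> \<delta>) has_vector_derivative \<phi>1 r *\<^sub>R velocity c \<gamma> (\<phi> r)) (at r)" if "r \<in> T'" for r
  proof -
    have "r \<in> J" using that by (simp add: T'_def)
    have "((coord c \<circ> \<gamma>) has_vector_derivative velocity c \<gamma> (\<phi> r)) (at (\<phi> r))"
      using smooth_on_vector_derivatives(1)[OF \<open>open T\<close> X \<phi>T[OF that]] by (simp add: velocity_def)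
    then show ?thesis
      using vector_diff_chain_at[OF \<phi>1[OF \<open>r \<in> J\<close>]] by (simp add: \<phi>(4) o_assoc)
  qed
  then have vel: "velocity c \<delta> r = \<phi>1 r *\<^sub>R velocity c \<gamma> (\<phi> r)" if "r \<in> T'" for r
    using that vector_derivative_at unfolding velocity_def by blast
  have "((\<lambda>r. velocity c \<gamma> (\<phi> r)) has_vector_derivative \<phi>1 s *\<^sub>R a) (at s)"
    using vector_diff_chain_at[OF \<phi>1[OF s(1)], of "velocity c \<gamma>" a] a s(2) by (simp add: o_def)
  then have "((\<lambda>r. \<phi>1 r *\<^sub>R velocity c \<gamma> (\<phi> r)) has_vector_derivative
      \<phi>1 s *\<^sub>R (\<phi>1 s *\<^sub>R a) + b *\<^sub>R velocity c \<gamma> (\<phi> s)) (at s)"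
    using b by (intro has_vector_derivative_scaleR) (simp_all add: has_real_derivative_iff_has_vector_derivative)
  \<comment> \<open>Second-order chain rule for \<gamma> composed with \<phi>, in the shape of
    \<open>geodesic_2jet_reparam\<close> with \<open>\<phi>1 s\<close> for \<open>l\<close> and the
    second derivative \<open>b\<close> of \<phi> for \<open>m\<close>.\<close>
  then have acc: "(velocity c \<delta> has_vector_derivative (\<phi>1 s)\<^sup>2 *\<^sub>R a + b *\<^sub>R velocity c \<gamma> t) (at s)"
    using has_vector_derivative_transform_within_open[OF _ \<open>open T'\<close> sT', of _ _ "velocity c \<delta>"] vel s(2)
    by (simp add: power2_eq_square)
  have "geodesic_2jet (\<omega> c (cinv c ((coord c \<circ> \<delta>) s))) (form_deriv (\<lambda>x. \<omega> c (cinv c x)) ((coord c \<circ> \<delta>) s))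
    (g c (cinv c ((coord c \<circ> \<delta>) s))) (tensor_deriv (\<lambda>x. g c (cinv c x)) ((coord c \<circ> \<delta>) s)) (velocity c \<delta> s)
    ((\<phi>1 s)\<^sup>2 *\<^sub>R a + b *\<^sub>R velocity c \<gamma> t)"
  proof (rule F.geodesic_2jet_if_euler_lagrange[OF \<open>open T'\<close> sT' _ _ acc])
    fix r assume r: "r \<in> T'"
    then have r': "\<delta> r \<in> cdom c" "r \<in> J" by (auto simp: T'_def)
    show "(coord c \<circ> \<delta>) r \<in> coord c ` cdom c"
      using r' by auto
    show "(coord c \<circ> \<delta> has_vector_derivative velocity c \<delta> r) (at r)"
      using V[OF r] vel[OF r] by simp
    show "\<omega> c (cinv c ((coord c \<circ> \<delta>) r)) (velocity c \<delta> r) \<noteq> 0"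
      using nz[OF r'(2,1)] ch(1)[OF r'(1)] by simp
  next
    fix v
    have "((\<lambda>r. frechet_derivative (\<lambda>\<xi>. kropina g \<omega> c (\<delta> r) \<xi>) (at (velocity c \<delta> r)) v) has_real_derivative
      frechet_derivative (\<lambda>x. kropina g \<omega> c (cinv c x) (velocity c \<delta> s)) (at (coord c (\<delta> s))) v) (at s)"
      using EL c sT' by (auto simp: euler_lagrange_def T'_def)
    \<comment> \<open>Parameters near \<open>s\<close> stay in the chart domain, where
      \<open>cinv c\<close> inverts \<open>coord c\<close>; the Lagrangian along the curve is there
      its coordinate expression.\<close>
    from has_field_derivative_transform_within_open[OF this \<open>open T'\<close> sT', of
      "\<lambda>r. frechet_derivative (\<lambda>\<xi>. g c (cinv c ((coord c \<circ> \<delta>) r)) \<xi> \<xi> /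
        \<omega> c (cinv c ((coord c \<circ> \<delta>) r)) \<xi>) (at (velocity c \<delta> r)) v"]
    show "((\<lambda>r. frechet_derivative (\<lambda>\<xi>. g c (cinv c ((coord c \<circ> \<delta>) r)) \<xi> \<xi> /
        \<omega> c (cinv c ((coord c \<circ> \<delta>) r)) \<xi>) (at (velocity c \<delta> r)) v)
      has_real_derivative frechet_derivative (\<lambda>x. g c (cinv c x) (velocity c \<delta> s) (velocity c \<delta> s) /
        \<omega> c (cinv c x) (velocity c \<delta> s)) (at ((coord c \<circ> \<delta>) s)) v) (at s)"
      using ch(1) by (simp add: kropina_def T'_def)
  qed
  then have jet: "geodesic_2jet (\<omega> c (\<gamma> t)) (form_deriv (\<lambda>x. \<omega> c (cinv c x)) (coord c (\<gamma> t)))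
    (g c (\<gamma> t)) (tensor_deriv (\<lambda>x. g c (cinv c x)) (coord c (\<gamma> t))) (\<phi>1 s *\<^sub>R velocity c \<gamma> t)
    ((\<phi>1 s)\<^sup>2 *\<^sub>R a + b *\<^sub>R velocity c \<gamma> t)"
    using s t ch(1)[OF t(2)] vel[OF sT'] \<phi>(4) by simp
  have "deriv \<phi> s = \<phi>1 s"
    using \<phi>1[OF s(1)] by (simp add: DERIV_imp_deriv has_real_derivative_iff_has_vector_derivative)
  then have "\<phi>1 s \<noteq> 0"
    using \<phi>(3)[OF s(1)] by simp
  have "coord c (\<gamma> t) \<in> coord c ` cdom c" using t by simp
  from F.kropina_1jet[OF this] have "kropina_1jet (\<omega> c (\<gamma> t)) (form_deriv (\<lambda>x. \<omega> c (cinv c x)) (coord c (\<gamma> t)))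
    (g c (\<gamma> t)) (tensor_deriv (\<lambda>x. g c (cinv c x)) (coord c (\<gamma> t)))"
    by (simp add: ch(1)[OF t(2)])
  from kropina_1jet.geodesic_2jet_reparam[OF this jet \<open>\<phi>1 s \<noteq> 0\<close>] show ?thesis .
qed

text \<open>The pointwise arguments use projective equivalence only in this form. A common curve
  through the point has one second derivative in the chart, and that \<open>a\<close> serves both
  metrics.\<close>

lemma common_geodesic_2jets:
  assumes atlas: "smooth_atlas A"
    and pair: "kropina_pair A g \<omega>" and nondeg: "nondegenerate_on_kernel A g \<omega>"
    and pairh: "kropina_pair A gh \<omega>h" and nondegh: "nondegenerate_on_kernel A gh \<omega>h"
    and equiv: "projectively_equivalent A g \<omega> gh \<omega>h"
    and c: "c \<in> A" and x: "x \<in> coord c ` cdom c"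
  obtains W where "open W" and "W \<noteq> {}"
    and "\<And>\<xi>. \<xi> \<in> W \<Longrightarrow> \<exists>a.
      geodesic_2jet (\<omega> c (cinv c x)) (form_deriv (\<lambda>x. \<omega> c (cinv c x)) x)
        (g c (cinv c x)) (tensor_deriv (\<lambda>x. g c (cinv c x)) x) \<xi> a \<and>
      geodesic_2jet (\<omega>h c (cinv c x)) (form_deriv (\<lambda>x. \<omega>h c (cinv c x)) x)
        (gh c (cinv c x)) (tensor_deriv (\<lambda>x. gh c (cinv c x)) x) \<xi> a"
proof -
  note ch = chart_inverse[OF smooth_atlas_chart[OF atlas c]]
  define p where "p = cinv c x"
  have p: "p \<in> cdom c" "coord c p = x"
    using ch(2,3)[OF x] by (auto simp: p_def)
  obtain S where S: "sufficiently_big A S"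
    "\<And>\<Gamma>. \<Gamma> \<in> S \<Longrightarrow> unparameterized_geodesic A g \<omega> \<Gamma> \<and> unparameterized_geodesic A gh \<omega>h \<Gamma>"
    using equiv by (auto simp: projectively_equivalent_def)
  obtain W where W: "open W" "W \<noteq> {}" "W \<subseteq> {velocity c \<gamma> t | I \<gamma> t. (I, \<gamma>) \<in> S \<and> t \<in> I \<and> \<gamma> t = p}"
    using S(1) c p(1) unfolding sufficiently_big_def by meson
  show thesis
  proof (rule that[OF W(1,2)])
    fix \<xi> assume "\<xi> \<in> W"
    then obtain I \<gamma> t where \<gamma>: "\<xi> = velocity c \<gamma> t" "(I, \<gamma>) \<in> S" "t \<in> I" "\<gamma> t = p"
      using W(3) by blast
    have reg: "smooth_regular_curve A (I, \<gamma>)"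
      using S(1) \<gamma>(2) by (auto simp: sufficiently_big_def)
    then have I: "open I" "continuous_on I \<gamma>" "smooth_on {r \<in> I. \<gamma> r \<in> cdom c} (coord c \<circ> \<gamma>)"
      using c by (auto simp: smooth_regular_curve_def)
    have "open {r \<in> I. \<gamma> r \<in> cdom c}"
      using continuous_open_preimage[OF I(2,1) ch(4)] by (auto simp: vimage_def Int_def)
    then obtain a where a: "(velocity c \<gamma> has_vector_derivative a) (at t)"
      using smooth_on_vector_derivatives(2)[OF _ I(3), of t] \<gamma>(3,4) p(1)
      unfolding velocity_def by auto
    have t: "\<gamma> t \<in> cdom c" using \<gamma>(4) p(1) by simp
    show "\<exists>a. geodesic_2jet (\<omega> c (cinv c x)) (form_deriv (\<lambda>x. \<omega> c (cinv c x)) x)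
        (g c (cinv c x)) (tensor_deriv (\<lambda>x. g c (cinv c x)) x) \<xi> a \<and>
      geodesic_2jet (\<omega>h c (cinv c x)) (form_deriv (\<lambda>x. \<omega>h c (cinv c x)) x)
        (gh c (cinv c x)) (tensor_deriv (\<lambda>x. gh c (cinv c x)) x) \<xi> a"
      using geodesic_2jet_if_unparameterized_geodesic[OF atlas pair nondeg c reg \<gamma>(3) t conjunct1[OF S(2)[OF \<gamma>(2)]] a]
        geodesic_2jet_if_unparameterized_geodesic[OF atlas pairh nondegh c reg \<gamma>(3) t conjunct2[OF S(2)[OF \<gamma>(2)]] a]
      by (auto simp: \<gamma>(1,4) p(2) p_def[symmetric])
  qed
qed

section \<open>Points of non-integrability\<close>

text \<open>The set where \<open>f\<close> is nonzero is open and contained in the null set, hence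
  empty.\<close>

lemma continuous_eq_0_if_ae:
  fixes f :: "'a::euclidean_space \<Rightarrow> real"
  assumes "open U" and "continuous_on U f" and "negligible N"
    and "\<And>x. x \<in> U \<Longrightarrow> x \<notin> N \<Longrightarrow> f x = 0" and "x \<in> U"
  shows "f x = 0"
proof (rule ccontr)
  assume "f x \<noteq> 0"
  have "open (U \<inter> f -` (- {0}))"
    using assms(1,2) by (intro continuous_open_preimage) auto
  moreover have "U \<inter> f -` (- {0}) \<subseteq> N"
    using assms(4) by auto
  then have "negligible (U \<inter> f -` (- {0}))"
    using assms(3) negligible_subset by blast
  moreover have "U \<inter> f -` (- {0}) \<noteq> {}"
    using assms(5) \<open>f x \<noteq> 0\<close> by auto
  ultimately show False
    using open_not_negligible by blast
qed

text \<open>If \<theta> vanished on pairs of kernel vectors, then \<theta>(u,v) = \<omega>(u)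
  \<theta>(e,v) - \<omega>(v) \<theta>(e,u) for \<omega>(e) = 1; thus \<theta> would be divisible by
  \<omega> and the wedge product would be zero.\<close>

lemma kernel_pair_if_wedge12:
  assumes lin: "linear (\<omega> c p)" and bil: "bilinear (\<theta> c p)" and skew: "\<And>u v. \<theta> c p v u = - \<theta> c p u v"
    and wedge: "wedge12 \<omega> \<theta> c p x y z \<noteq> 0"
  obtains u v where "\<omega> c p u = 0" and "\<omega> c p v = 0" and "\<theta> c p u v \<noteq> 0"
proof (rule ccontr)
  assume "\<not> thesis"
  then have zero: "\<theta> c p u v = 0" if "\<omega> c p u = 0" "\<omega> c p v = 0" for u v
    using that \<open>\<And>u v. \<omega> c p u = 0 \<Longrightarrow> \<omega> c p v = 0 \<Longrightarrow> \<theta> c p u v \<noteq> 0 \<Longrightarrow> thesis\<close> by blast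
  have "\<exists>v. \<omega> c p v \<noteq> 0"
    by (rule ccontr) (use wedge in \<open>simp add: wedge12_def\<close>)
  then obtain e where e: "\<omega> c p e = 1"
    using normalized_vector[OF lin] by blast
  note P = kernel_proj[OF lin e]
  have "\<theta> c p e e = 0" using skew[of e e] by simp
  then have *: "\<theta> c p u v = \<omega> c p u * \<theta> c p e v - \<omega> c p v * \<theta> c p e u" for u v
    using zero[OF P(2) P(2), of u v] skew[of u e]
    by (simp add: kernel_proj_def bilinear_lsub[OF bil] bilinear_rsub[OF bil] bilinear_lmul[OF bil]
        bilinear_rmul[OF bil] algebra_simps)
  have "wedge12 \<omega> \<theta> c p x y z = 0"
    unfolding wedge12_def *[of y z] *[of z x] *[of x y] by (simp add: algebra_simps)
  with wedge show False by simp
qed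

text \<open>The vectors \<open>u\<close> and \<open>e\<close> span a plane, and a linear form has a
  nonzero zero on it. This carries nontriviality of the kernel from one form to any other.\<close>

lemma kernel_nonzero:
  fixes f h :: "'a::real_vector \<Rightarrow> real"
  assumes "linear f" and "f u = 0" and "u \<noteq> 0" and "f e \<noteq> 0" and "linear h"
  obtains z where "h z = 0" and "z \<noteq> 0"
proof (cases "h u = 0")
  case False
  let ?z = "h e *\<^sub>R u - h u *\<^sub>R e"
  have "f ?z \<noteq> 0"
    using assms False by (simp add: linear_diff linear_cmul)
  then have "?z \<noteq> 0"
    using linear_0[OF assms(1)] by metis
  moreover have "h ?z = 0"
    using assms(5) by (simp add: linear_diff linear_cmul)
  ultimately show thesis using that by blast
qed (use assms that in blast)

lemma nonintegrable_points:
  assumes atlas: "smooth_atlas A" and pair: "kropina_pair A g \<omega>" and nondeg: "nondegenerate_on_kernel A g \<omega>"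
    and nonint: "kernel_nonintegrable_ae A \<omega>" and c: "c \<in> A"
  obtains N where "negligible N"
    and "\<And>x. x \<in> coord c ` cdom c \<Longrightarrow> x \<notin> N \<Longrightarrow> \<exists>u v. \<omega> c (cinv c x) u = 0 \<and> \<omega> c (cinv c x) v = 0 \<and>
      form_deriv (\<lambda>x. \<omega> c (cinv c x)) x u v \<noteq> form_deriv (\<lambda>x. \<omega> c (cinv c x)) x v u"
proof -
  note ch = chart_inverse[OF smooth_atlas_chart[OF atlas c]]
  interpret F: kropina_field "coord c ` cdom c" "\<lambda>x. \<omega> c (cinv c x)" "\<lambda>x. g c (cinv c x)"
    by (rule kropina_field_chart[OF atlas pair nondeg c])
  show thesis
  proof (rule that)
    show "negligible (coord c ` {p \<in> cdom c. \<not> (\<exists>u v w. wedge12 \<omega> (ext_deriv \<omega>) c p u v w \<noteq> 0)})"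
      using nonint c by (simp add: kernel_nonintegrable_ae_def almost_every_point_def)
    fix x assume x: "x \<in> coord c ` cdom c"
      "x \<notin> coord c ` {p \<in> cdom c. \<not> (\<exists>u v w. wedge12 \<omega> (ext_deriv \<omega>) c p u v w \<noteq> 0)}"
    interpret J: kropina_1jet "\<omega> c (cinv c x)" "form_deriv (\<lambda>x. \<omega> c (cinv c x)) x" "g c (cinv c x)"
        "tensor_deriv (\<lambda>x. g c (cinv c x)) x"
      by (rule F.kropina_1jet[OF x(1)])
    have ext: "ext_deriv \<omega> c (cinv c x) u v = form_deriv (\<lambda>x. \<omega> c (cinv c x)) x u v
        - form_deriv (\<lambda>x. \<omega> c (cinv c x)) x v u" for u v
      by (simp add: ext_deriv_form_deriv ch(3)[OF x(1)])
    obtain y z w where wedge: "wedge12 \<omega> (ext_deriv \<omega>) c (cinv c x) y z w \<noteq> 0"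
    proof -
      have "cinv c x \<notin> {p \<in> cdom c. \<not> (\<exists>u v w. wedge12 \<omega> (ext_deriv \<omega>) c p u v w \<noteq> 0)}" (is "_ \<notin> ?B")
      proof
        assume "cinv c x \<in> ?B"
        then have "coord c (cinv c x) \<in> coord c ` ?B"
          by (rule imageI)
        with x(2) show False
          by (simp only: ch(3)[OF x(1)])
      qed
      then show thesis
        using ch(2)[OF x(1)] that by blast
    qed
    have "bilinear (ext_deriv \<omega> c (cinv c x))"
      by (auto simp: bilinear_def ext J.dform_simps algebra_simps intro!: linearI)
    moreover have "ext_deriv \<omega> c (cinv c x) v u = - ext_deriv \<omega> c (cinv c x) u v" for u v
      by (simp add: ext)
    ultimately obtain u v where "\<omega> c (cinv c x) u = 0" "\<omega> c (cinv c x) v = 0" "ext_deriv \<omega> c (cinv c x) u v \<noteq> 0"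
      using kernel_pair_if_wedge12[where \<omega> = \<omega> and \<theta> = "ext_deriv \<omega>", OF J.linear_form _ _ wedge] by metis
    then show "\<exists>u v. \<omega> c (cinv c x) u = 0 \<and> \<omega> c (cinv c x) v = 0 \<and>
      form_deriv (\<lambda>x. \<omega> c (cinv c x)) x u v \<noteq> form_deriv (\<lambda>x. \<omega> c (cinv c x)) x v u"
      by (auto simp: ext)
  qed
qed

text \<open>Non-integrability at a single point of the chart yields a nonzero kernel vector there,
  and \<open>kernel_nonzero\<close> moves this to every point of the chart, also to those of the
  exceptional null set.\<close>

lemma kernel_nontrivial:
  assumes atlas: "smooth_atlas A" and pair: "kropina_pair A g \<omega>" and nondeg: "nondegenerate_on_kernel A g \<omega>"
    and nonint: "kernel_nonintegrable_ae A \<omega>"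
    and c: "c \<in> (A :: ('m::{t2_space,second_countable_topology}, 'e::euclidean_space) chart set)" and p: "p \<in> cdom c"
  obtains z where "\<omega> c p z = 0" and "z \<noteq> 0"
proof -
  note ch = chart_inverse[OF smooth_atlas_chart[OF atlas c]]
  interpret F: kropina_field "coord c ` cdom c" "\<lambda>x. \<omega> c (cinv c x)" "\<lambda>x. g c (cinv c x)"
    by (rule kropina_field_chart[OF atlas pair nondeg c])
  obtain N where N: "negligible N"
    "\<And>x. x \<in> coord c ` cdom c \<Longrightarrow> x \<notin> N \<Longrightarrow> \<exists>u v. \<omega> c (cinv c x) u = 0 \<and> \<omega> c (cinv c x) v = 0 \<and>
      form_deriv (\<lambda>x. \<omega> c (cinv c x)) x u v \<noteq> form_deriv (\<lambda>x. \<omega> c (cinv c x)) x v u"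
    using nonintegrable_points[OF atlas pair nondeg nonint c] by blast
  have "\<not> coord c ` cdom c \<subseteq> N"
    using open_not_negligible[OF ch(5)] negligible_subset[OF N(1)] p by blast
  then obtain x u v where x: "x \<in> coord c ` cdom c" and uv: "\<omega> c (cinv c x) u = 0"
      "form_deriv (\<lambda>x. \<omega> c (cinv c x)) x u v \<noteq> form_deriv (\<lambda>x. \<omega> c (cinv c x)) x v u"
    using N(2) by blast
  interpret J: kropina_1jet "\<omega> c (cinv c x)" "form_deriv (\<lambda>x. \<omega> c (cinv c x)) x" "g c (cinv c x)"
      "tensor_deriv (\<lambda>x. g c (cinv c x)) x"
    by (rule F.kropina_1jet[OF x])
  have "u \<noteq> 0"
    using uv(2) bilinear_lzero[OF J.bilinear_dform] bilinear_rzero[OF J.bilinear_dform] by auto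
  moreover obtain e where "\<omega> c (cinv c x) e \<noteq> 0"
    using J.nonzero by blast
  moreover have "linear (\<omega> c p)"
    using pair c p by (auto simp: kropina_pair_def one_form_def)
  ultimately show thesis
    using kernel_nonzero[OF J.linear_form uv(1)] that by blast
qed

text \<open>Inclusion of kernels is known only off a null set. As vanishing 2x2 minors it becomes an
  identity between continuous functions, which holds at all points.\<close>

lemma forms_proportional:
  assumes atlas: "smooth_atlas A"
    and pair: "kropina_pair A g \<omega>" and nondeg: "nondegenerate_on_kernel A g \<omega>"
    and pairh: "kropina_pair A gh \<omega>h" and nondegh: "nondegenerate_on_kernel A gh \<omega>h"
    and equiv: "projectively_equivalent A g \<omega> gh \<omega>h"
    and nonint: "kernel_nonintegrable_ae A \<omega>"
    and c: "c \<in> A" and p: "p \<in> cdom c"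
  shows "\<omega> c p u * \<omega>h c p v = \<omega> c p v * \<omega>h c p u"
proof -
  note ch = chart_inverse[OF smooth_atlas_chart[OF atlas c]]
  interpret F: kropina_field "coord c ` cdom c" "\<lambda>x. \<omega> c (cinv c x)" "\<lambda>x. g c (cinv c x)"
    by (rule kropina_field_chart[OF atlas pair nondeg c])
  interpret Fh: kropina_field "coord c ` cdom c" "\<lambda>x. \<omega>h c (cinv c x)" "\<lambda>x. gh c (cinv c x)"
    by (rule kropina_field_chart[OF atlas pairh nondegh c])
  obtain N where N: "negligible N"
    "\<And>x. x \<in> coord c ` cdom c \<Longrightarrow> x \<notin> N \<Longrightarrow> \<exists>u v. \<omega> c (cinv c x) u = 0 \<and> \<omega> c (cinv c x) v = 0 \<and>
      form_deriv (\<lambda>x. \<omega> c (cinv c x)) x u v \<noteq> form_deriv (\<lambda>x. \<omega> c (cinv c x)) x v u"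
    using nonintegrable_points[OF atlas pair nondeg nonint c] by blast
  let ?f = "\<lambda>x. \<omega> c (cinv c x) u * \<omega>h c (cinv c x) v - \<omega> c (cinv c x) v * \<omega>h c (cinv c x) u"
  have "?f (coord c p) = 0"
  proof (rule continuous_eq_0_if_ae[where f = ?f, OF ch(5) _ N(1)])
    show "continuous_on (coord c ` cdom c) ?f"
      by (intro continuous_intros smooth_on_continuous F.smooth_form Fh.smooth_form)
    show "coord c p \<in> coord c ` cdom c" using p by simp
    fix x assume x: "x \<in> coord c ` cdom c" "x \<notin> N"
    note J = F.kropina_1jet[OF x(1)] and Jh = Fh.kropina_1jet[OF x(1)]
    obtain y z where yz: "\<omega> c (cinv c x) y = 0" "\<omega> c (cinv c x) z = 0"
      "form_deriv (\<lambda>x. \<omega> c (cinv c x)) x y z \<noteq> form_deriv (\<lambda>x. \<omega> c (cinv c x)) x z y"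
      using N(2)[OF x] by blast
    obtain W where W: "open W" "W \<noteq> {}" "\<And>\<xi>. \<xi> \<in> W \<Longrightarrow> \<exists>a.
      geodesic_2jet (\<omega> c (cinv c x)) (form_deriv (\<lambda>x. \<omega> c (cinv c x)) x)
        (g c (cinv c x)) (tensor_deriv (\<lambda>x. g c (cinv c x)) x) \<xi> a \<and>
      geodesic_2jet (\<omega>h c (cinv c x)) (form_deriv (\<lambda>x. \<omega>h c (cinv c x)) x)
        (gh c (cinv c x)) (tensor_deriv (\<lambda>x. gh c (cinv c x)) x) \<xi> a"
      using common_geodesic_2jets[OF atlas pair nondeg pairh nondegh equiv c x(1)] by blast
    note ker = kernel_subset_if_common_geodesics[OF J Jh W yz]
    note lin = kropina_1jet.linear_form[OF J] and linh = kropina_1jet.linear_form[OF Jh]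
    obtain e where e: "\<omega> c (cinv c x) e = 1"
      using kropina_1jet.exists_unit[OF J] .
    have eq: "\<omega>h c (cinv c x) y = \<omega> c (cinv c x) y * \<omega>h c (cinv c x) e" for y
      using ker[OF _ kernel_proj(2)[OF lin e, of y]]
      by (simp add: kernel_proj_def linear_diff[OF linh] linear_cmul[OF linh])
    show "?f x = 0"
      unfolding eq[of u] eq[of v] by simp
  qed
  then show ?thesis
    by (simp add: ch(1)[OF p])
qed

lemma sum_squares_Basis_pos:
  fixes f :: "'a::euclidean_space \<Rightarrow> real"
  assumes "linear f" and "f v \<noteq> 0"
  shows "(\<Sum>b\<in>Basis. f b * f b) > 0"
proof -
  have "\<exists>b\<in>Basis. f b \<noteq> 0"
    using linear_expand[OF assms(1), of v] assms(2) by (metis (no_types, lifting) mult_zero_right real_scaleR_def sum.neutral)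
  then show ?thesis
    by (auto intro!: sum_pos2 simp: zero_less_mult_iff)
qed

lemma conformal_factor_of_forms:
  assumes atlas: "smooth_atlas A"
    and form: "one_form A \<omega>" and nz: "\<And>c p. c \<in> A \<Longrightarrow> p \<in> cdom c \<Longrightarrow> \<exists>v. \<omega> c p v \<noteq> 0"
    and formh: "one_form A \<omega>h" and nzh: "\<And>c p. c \<in> A \<Longrightarrow> p \<in> cdom c \<Longrightarrow> \<exists>v. \<omega>h c p v \<noteq> 0"
    and parallel: "\<And>c p u v. c \<in> A \<Longrightarrow> p \<in> cdom c \<Longrightarrow> \<omega> c p u * \<omega>h c p v = \<omega> c p v * \<omega>h c p u"
  obtains \<alpha> where "smooth_function A \<alpha>" and "\<And>p. \<alpha> p \<noteq> 0"
    and "\<And>c p v. c \<in> A \<Longrightarrow> p \<in> cdom c \<Longrightarrow> \<omega> c p v = \<alpha> p * \<omega>h c p v"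
proof -
  have "\<exists>a. \<forall>c\<in>A. p \<in> cdom c \<longrightarrow> (\<forall>v. \<omega> c p v = a * \<omega>h c p v)" for p
  proof -
    obtain d where d: "d \<in> A" "p \<in> cdom d"
      using smooth_atlas_cover[OF atlas] .
    \<comment> \<open>The factor is read off in one chart \<open>d\<close> around \<open>p\<close>
      from a vector with nonzero \<open>\<omega>h\<close>; the transformation law gives the same
      factor in all charts.\<close>
    obtain e where e: "\<omega>h d p e \<noteq> 0" using nzh[OF d] by blast
    have "\<omega> c p v = \<omega> d p e / \<omega>h d p e * \<omega>h c p v" if c: "c \<in> A" "p \<in> cdom c" for c v
      using parallel[OF d, of "transfer c d p v" e] e
        one_formD(3)[OF form c(1) d(1) c(2) d(2)] one_formD(3)[OF formh c(1) d(1) c(2) d(2)]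
      by (simp add: field_simps)
    then show ?thesis by blast
  qed
  then obtain \<alpha> where \<alpha>: "\<And>c p v. c \<in> A \<Longrightarrow> p \<in> cdom c \<Longrightarrow> \<omega> c p v = \<alpha> p * \<omega>h c p v"
    by metis
  show thesis
  proof (rule that[OF _ _ \<alpha>])
    show "\<alpha> p \<noteq> 0" for p
    proof -
      obtain d where d: "d \<in> A" "p \<in> cdom d"
        using smooth_atlas_cover[OF atlas] .
      then show ?thesis
        using \<alpha>[OF d] nz[OF d] by auto
    qed
    show "smooth_function A \<alpha>"
      unfolding smooth_function_def
    proof
      fix c assume c: "c \<in> A"
      note ch = chart_inverse[OF smooth_atlas_chart[OF atlas c]]
      let ?w = "\<lambda>x. \<omega> c (cinv c x)" and ?wh = "\<lambda>x. \<omega>h c (cinv c x)"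
      have pos: "(\<Sum>b\<in>Basis. ?wh x b * ?wh x b) \<noteq> 0" if "x \<in> coord c ` cdom c" for x
        using sum_squares_Basis_pos one_formD(1)[OF formh c] nzh[OF c] ch(2)[OF that]
        by (metis less_irrefl)
      \<comment> \<open>This quotient equals \<alpha> and is smooth on the whole chart: its
        denominator is a sum of squares without zeros, so no nonvanishing component has to be
        selected locally.\<close>
      have "smooth_on (coord c ` cdom c) (\<lambda>x. (\<Sum>b\<in>Basis. ?w x b * ?wh x b) / (\<Sum>b\<in>Basis. ?wh x b * ?wh x b))"
        by (intro smooth_on_divide smooth_on_intros ch(5) one_formD(2)[OF form c] one_formD(2)[OF formh c] pos)
      then show "smooth_on (coord c ` cdom c) (\<alpha> \<circ> cinv c)"
      proof (rule smooth_on_cong[OF ch(5), rotated])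
        fix x assume x: "x \<in> coord c ` cdom c"
        have "(\<Sum>b\<in>Basis. ?w x b * ?wh x b) = \<alpha> (cinv c x) * (\<Sum>b\<in>Basis. ?wh x b * ?wh x b)"
          by (simp add: \<alpha>[OF c ch(2)[OF x]] sum_distrib_left mult.assoc)
        then show "(\<Sum>b\<in>Basis. ?w x b * ?wh x b) / (\<Sum>b\<in>Basis. ?wh x b * ?wh x b) = (\<alpha> \<circ> cinv c) x"
          using pos[OF x] by simp
      qed
    qed
  qed
qed

section \<open>Metrics with a common kernel\<close>

text \<open>With \<open>e\<close> dual to \<open>\<omega>\<close> in coordinates, \<open>kernel_form \<omega> g u v\<close> is \<open>g(Pu, Pv)\<close> for
  \<open>Pu = \<omega>(e)u - \<omega>(u)e \<in> ker \<omega>\<close>, written out so that it is visibly smooth in the point.\<close>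

definition dual_sum :: "('a::euclidean_space \<Rightarrow> real) \<Rightarrow> ('a \<Rightarrow> real) \<Rightarrow> real"
  where "dual_sum \<omega> f = (\<Sum>b\<in>Basis. \<omega> b * f b)"

definition kernel_form :: "('a::euclidean_space \<Rightarrow> real) \<Rightarrow> ('a \<Rightarrow> 'a \<Rightarrow> real) \<Rightarrow> 'a \<Rightarrow> 'a \<Rightarrow> real"
  where "kernel_form \<omega> g u v =
    dual_sum \<omega> \<omega> * dual_sum \<omega> \<omega> * g u v - dual_sum \<omega> \<omega> * \<omega> v * dual_sum \<omega> (g u)
    - dual_sum \<omega> \<omega> * \<omega> u * dual_sum \<omega> (g v) + \<omega> u * \<omega> v * dual_sum \<omega> (\<lambda>b. dual_sum \<omega> (g b))"

lemma dual_sum_eq: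
  assumes "linear f"
  shows "dual_sum \<omega> f = f (\<Sum>b\<in>Basis. \<omega> b *\<^sub>R b)"
  using assms by (simp add: dual_sum_def linear_sum linear_cmul)

lemma kernel_form_eq:
  fixes g :: "'a::euclidean_space \<Rightarrow> 'a \<Rightarrow> real"
  assumes lin: "linear \<omega>" and bil: "bilinear g" and sym: "\<And>u v. g u v = g v u"
  defines "e \<equiv> \<Sum>b\<in>Basis. \<omega> b *\<^sub>R b"
  shows "kernel_form \<omega> g u v = g (\<omega> e *\<^sub>R u - \<omega> u *\<^sub>R e) (\<omega> e *\<^sub>R v - \<omega> v *\<^sub>R e)"
proof -
  have l: "linear (g u)" "linear (\<lambda>u. g u v)" for u v
    using bil by (auto simp: bilinear_def)
  have "dual_sum \<omega> (g b) = g b e" for b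
    unfolding e_def by (rule dual_sum_eq[OF l(1)])
  moreover have "dual_sum \<omega> \<omega> = \<omega> e"
    unfolding e_def by (rule dual_sum_eq[OF lin])
  moreover have "dual_sum \<omega> (\<lambda>b. g b e) = g e e"
    using dual_sum_eq[OF l(2)] by (simp add: e_def)
  ultimately show ?thesis
    using sym[of v e]
    by (simp add: kernel_form_def bilinear_lsub[OF bil] bilinear_rsub[OF bil] bilinear_lmul[OF bil]
        bilinear_rmul[OF bil] algebra_simps)
qed

lemma dual_sum_self_pos:
  assumes "linear \<omega>" and "\<omega> v \<noteq> 0"
  shows "dual_sum \<omega> \<omega> > 0"
  unfolding dual_sum_def by (rule sum_squares_Basis_pos[OF assms])

lemma kernel_form_kernel:
  fixes g :: "'a::euclidean_space \<Rightarrow> 'a \<Rightarrow> real"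
  assumes "\<omega> u = 0" and "\<omega> v = 0"
  shows "kernel_form \<omega> g u v = dual_sum \<omega> \<omega> * dual_sum \<omega> \<omega> * g u v"
  using assms by (simp add: kernel_form_def)

lemma smooth_kernel_form:
  assumes "open U" and "\<And>v. smooth_on U (\<lambda>y. w y v)" and "\<And>u v. smooth_on U (\<lambda>y. G y u v)"
  shows "smooth_on U (\<lambda>y. kernel_form (w y) (G y) u v)"
  unfolding kernel_form_def dual_sum_def by (intro smooth_on_intros assms)

text \<open>The solution \<open>\<beta>\<close> of \<open>2 h(u,v) = \<omega>(u)\<beta>(v) + \<omega>(v)\<beta>(u)\<close>, read off from \<open>v = e\<close>.\<close>

definition perturbation_form ::
  "('a::euclidean_space \<Rightarrow> real) \<Rightarrow> ('a \<Rightarrow> 'a \<Rightarrow> real) \<Rightarrow> 'a \<Rightarrow> real"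
  where "perturbation_form \<omega> h u =
    (2 * dual_sum \<omega> (h u) - \<omega> u * dual_sum \<omega> (\<lambda>b. dual_sum \<omega> (h b)) / dual_sum \<omega> \<omega>) / dual_sum \<omega> \<omega>"

lemma perturbation_form:
  fixes h :: "'a::euclidean_space \<Rightarrow> 'a \<Rightarrow> real"
  assumes lin: "linear \<omega>" and nz: "\<omega> x \<noteq> 0" and bil: "bilinear h" and sym: "\<And>u v. h u v = h v u"
    and zero: "\<And>u v. \<omega> u = 0 \<Longrightarrow> \<omega> v = 0 \<Longrightarrow> h u v = 0"
  shows "linear (perturbation_form \<omega> h)"
    and "h u v = (\<omega> u * perturbation_form \<omega> h v + \<omega> v * perturbation_form \<omega> h u) / 2"
proof -
  define e where "e = (\<Sum>b\<in>Basis. \<omega> b *\<^sub>R b)"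
  have l: "linear (h u)" "linear (\<lambda>u. h u v)" for u v
    using bil by (auto simp: bilinear_def)
  have he: "dual_sum \<omega> (h b) = h b e" for b
    unfolding e_def by (rule dual_sum_eq[OF l(1)])
  have \<omega>e: "dual_sum \<omega> \<omega> = \<omega> e"
    unfolding e_def by (rule dual_sum_eq[OF lin])
  have hee: "dual_sum \<omega> (\<lambda>b. h b e) = h e e"
    using dual_sum_eq[OF l(2)] by (simp add: e_def)
  have n: "\<omega> e \<noteq> 0"
    using dual_sum_self_pos[OF lin nz] by (simp add: \<omega>e)
  have pf: "perturbation_form \<omega> h u = (2 * h u e - \<omega> u * h e e / \<omega> e) / \<omega> e" for u
    by (simp add: perturbation_form_def he \<omega>e hee)
  show "linear (perturbation_form \<omega> h)"
    using n
    by (intro linearI) (simp_all add: pf linear_add[OF lin] linear_cmul[OF lin] bilinear_ladd[OF bil]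
      bilinear_lmul[OF bil] field_simps)
  \<comment> \<open>Both arguments lie in the kernel; expanding the product expresses h(u,v) through
    h(u,e), h(v,e) and h(e,e).\<close>
  have "h (\<omega> e *\<^sub>R u - \<omega> u *\<^sub>R e) (\<omega> e *\<^sub>R v - \<omega> v *\<^sub>R e) = 0"
    by (rule zero) (simp_all add: linear_diff[OF lin] linear_cmul[OF lin])
  then have "\<omega> e * \<omega> e * h u v = \<omega> e * \<omega> v * h u e + \<omega> e * \<omega> u * h v e - \<omega> u * \<omega> v * h e e"
    using sym[of e v]
    by (simp add: bilinear_lsub[OF bil] bilinear_rsub[OF bil] bilinear_lmul[OF bil]
        bilinear_rmul[OF bil] algebra_simps)
  then have "h u v = (\<omega> e * \<omega> v * h u e + \<omega> e * \<omega> u * h v e - \<omega> u * \<omega> v * h e e) / (\<omega> e * \<omega> e)"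
    using n by (simp add: field_simps)
  also have "\<dots> = (\<omega> u * perturbation_form \<omega> h v + \<omega> v * perturbation_form \<omega> h u) / 2"
    using n by (simp add: pf field_simps)
  finally show "h u v = (\<omega> u * perturbation_form \<omega> h v + \<omega> v * perturbation_form \<omega> h u) / 2" .
qed

lemma smooth_perturbation_form:
  assumes "open U" and "\<And>v. smooth_on U (\<lambda>y. w y v)" and "\<And>u v. smooth_on U (\<lambda>y. h y u v)"
    and "\<And>y. y \<in> U \<Longrightarrow> linear (w y)" and "\<And>y. y \<in> U \<Longrightarrow> \<exists>v. w y v \<noteq> 0"
  shows "smooth_on U (\<lambda>y. perturbation_form (w y) (h y) u)"
proof -
  have "dual_sum (w y) (w y) \<noteq> 0" if "y \<in> U" for y
    using dual_sum_self_pos assms(4,5)[OF that] by (metis less_irrefl)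
  then have "(\<Sum>b\<in>Basis. w y b * w y b) \<noteq> 0" if "y \<in> U" for y
    using that by (simp add: dual_sum_def)
  then show ?thesis
    unfolding perturbation_form_def dual_sum_def
    by (intro smooth_on_intros smooth_on_divide assms(1-3))
qed

text \<open>The symmetric product with a nonzero \<omega> determines the other factor. This passes
  the transformation law of the tensors on to \<beta>.\<close>

lemma symmetrized_product_unique:
  fixes f f' :: "'a::real_vector \<Rightarrow> real"
  assumes eq: "\<And>u v. \<omega> u * f v + \<omega> v * f u = \<omega> u * f' v + \<omega> v * f' u" and e: "\<omega> e \<noteq> (0::real)"
  shows "f u = f' u"
proof -
  have "f e = f' e" using eq[of e e] e by simp
  with eq[of e u] e show ?thesis by simp
qed

locale common_kernel =
  fixes A :: "('m::{t2_space,second_countable_topology}, 'e::euclidean_space) chart set"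
    and g gh :: "('m, 'e) two_tensor" and \<omega> :: "('m, 'e) tangent_function"
  assumes atlas: "smooth_atlas A" and connected: "connected (UNIV :: 'm set)"
    and pair: "kropina_pair A g \<omega>" and nondeg: "nondegenerate_on_kernel A g \<omega>"
    and pairh: "kropina_pair A gh \<omega>" and nondegh: "nondegenerate_on_kernel A gh \<omega>"
    and equiv: "projectively_equivalent A g \<omega> gh \<omega>"
    and nonint: "kernel_nonintegrable_ae A \<omega>"
begin

lemmas chart = chart_inverse[OF smooth_atlas_chart[OF atlas]]

lemma field: "c \<in> A \<Longrightarrow> kropina_field (coord c ` cdom c) (\<lambda>x. \<omega> c (cinv c x)) (\<lambda>x. g c (cinv c x))"
  by (rule kropina_field_chart[OF atlas pair nondeg])

lemma fieldh: "c \<in> A \<Longrightarrow> kropina_field (coord c ` cdom c) (\<lambda>x. \<omega> c (cinv c x)) (\<lambda>x. gh c (cinv c x))"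
  by (rule kropina_field_chart[OF atlas pairh nondegh])

lemma form: "one_form A \<omega>" and tensor: "symmetric_two_tensor A g" and tensorh: "symmetric_two_tensor A gh"
  and form_nonzero: "c \<in> A \<Longrightarrow> p \<in> cdom c \<Longrightarrow> \<exists>v. \<omega> c p v \<noteq> 0"
  using pair pairh by (auto simp: kropina_pair_def)

lemma jet:
  assumes c: "c \<in> A" and p: "p \<in> cdom c"
  shows "kropina_1jet (\<omega> c p) (form_deriv (\<lambda>x. \<omega> c (cinv c x)) (coord c p)) (g c p)
      (tensor_deriv (\<lambda>x. g c (cinv c x)) (coord c p))"
    and "kropina_1jet (\<omega> c p) (form_deriv (\<lambda>x. \<omega> c (cinv c x)) (coord c p)) (gh c p)
      (tensor_deriv (\<lambda>x. gh c (cinv c x)) (coord c p))"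
  using kropina_field.kropina_1jet[OF field[OF c], of "coord c p"]
    kropina_field.kropina_1jet[OF fieldh[OF c], of "coord c p"] p chart(1)[OF c p] by auto

lemma nonisotropic:
  assumes c: "c \<in> A" and p: "p \<in> cdom c"
  obtains \<eta> where "\<omega> c p \<eta> = 0" and "g c p \<eta> \<eta> \<noteq> 0"
  using kernel_nontrivial[OF atlas pair nondeg nonint c p] kropina_1jet.nonisotropic_vector[OF jet(1)[OF c p]]
  by metis

text \<open>Proportionality of \<open>gh\<close> and \<open>g\<close> on ker \<omega> as vanishing
  minors of \<open>kernel_form\<close>. No frame of the varying kernel is chosen, both sides are
  continuous in the point, and the identity extends from almost every point to all.\<close>

lemma kernel_forms_proportional:
  assumes c: "c \<in> A" and p: "p \<in> cdom c"
  shows "kernel_form (\<omega> c p) (gh c p) u v * kernel_form (\<omega> c p) (g c p) u' v' =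
    kernel_form (\<omega> c p) (g c p) u v * kernel_form (\<omega> c p) (gh c p) u' v'"
proof -
  interpret F: kropina_field "coord c ` cdom c" "\<lambda>x. \<omega> c (cinv c x)" "\<lambda>x. g c (cinv c x)"
    by (rule field[OF c])
  interpret Fh: kropina_field "coord c ` cdom c" "\<lambda>x. \<omega> c (cinv c x)" "\<lambda>x. gh c (cinv c x)"
    by (rule fieldh[OF c])
  obtain N where N: "negligible N"
    "\<And>x. x \<in> coord c ` cdom c \<Longrightarrow> x \<notin> N \<Longrightarrow> \<exists>u v. \<omega> c (cinv c x) u = 0 \<and> \<omega> c (cinv c x) v = 0 \<and>
      form_deriv (\<lambda>x. \<omega> c (cinv c x)) x u v \<noteq> form_deriv (\<lambda>x. \<omega> c (cinv c x)) x v u"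
    using nonintegrable_points[OF atlas pair nondeg nonint c] by blast
  let ?k = "\<lambda>x. kernel_form (\<omega> c (cinv c x)) (g c (cinv c x))"
    and ?kh = "\<lambda>x. kernel_form (\<omega> c (cinv c x)) (gh c (cinv c x))"
  let ?f = "\<lambda>x. ?kh x u v * ?k x u' v' - ?k x u v * ?kh x u' v'"
  have "?f (coord c p) = 0"
  proof (rule continuous_eq_0_if_ae[where f = ?f, OF chart(5)[OF c] _ N(1)])
    show "continuous_on (coord c ` cdom c) ?f"
      by (intro continuous_intros smooth_on_continuous smooth_kernel_form F.smooth_form F.smooth_tensor
          Fh.smooth_tensor F.open_domain)
    show "coord c p \<in> coord c ` cdom c" using p by simp
    fix x assume x: "x \<in> coord c ` cdom c" "x \<notin> N"
    interpret J: kropina_1jet "\<omega> c (cinv c x)" "form_deriv (\<lambda>x. \<omega> c (cinv c x)) x" "g c (cinv c x)"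
        "tensor_deriv (\<lambda>x. g c (cinv c x)) x"
      by (rule F.kropina_1jet[OF x(1)])
    interpret Jh: kropina_1jet "\<omega> c (cinv c x)" "form_deriv (\<lambda>x. \<omega> c (cinv c x)) x" "gh c (cinv c x)"
        "tensor_deriv (\<lambda>x. gh c (cinv c x)) x"
      by (rule Fh.kropina_1jet[OF x(1)])
    obtain y z where yz: "\<omega> c (cinv c x) y = 0" "\<omega> c (cinv c x) z = 0"
      "form_deriv (\<lambda>x. \<omega> c (cinv c x)) x y z \<noteq> form_deriv (\<lambda>x. \<omega> c (cinv c x)) x z y"
      using N(2)[OF x] by blast
    obtain W where W: "open W" "W \<noteq> {}" "\<And>\<xi>. \<xi> \<in> W \<Longrightarrow> \<exists>a.
      geodesic_2jet (\<omega> c (cinv c x)) (form_deriv (\<lambda>x. \<omega> c (cinv c x)) x)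
        (g c (cinv c x)) (tensor_deriv (\<lambda>x. g c (cinv c x)) x) \<xi> a \<and>
      geodesic_2jet (\<omega> c (cinv c x)) (form_deriv (\<lambda>x. \<omega> c (cinv c x)) x)
        (gh c (cinv c x)) (tensor_deriv (\<lambda>x. gh c (cinv c x)) x) \<xi> a"
      using common_geodesic_2jets[OF atlas pair nondeg pairh nondegh equiv c x(1)] by blast
    obtain k where k: "\<And>y z. \<omega> c (cinv c x) y = 0 \<Longrightarrow> \<omega> c (cinv c x) z = 0 \<Longrightarrow>
        gh c (cinv c x) y z = k * g c (cinv c x) y z"
      using conformal_on_kernel_if_common_geodesics[OF J.kropina_1jet_axioms Jh.kropina_1jet_axioms W yz]
      by blast
    have "?kh x u v = k * ?k x u v" for u v
      unfolding kernel_form_eq[OF J.linear_form J.bilinear_tensor J.sym]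
        kernel_form_eq[OF J.linear_form Jh.bilinear_tensor Jh.sym]
      by (rule k) (simp_all add: J.form_simps)
    then show "?f x = 0"
      by simp
  qed
  then show ?thesis
    by (simp add: chart(1)[OF c p])
qed

lemma conformal_factor:
  obtains C where "\<And>c p u v. c \<in> A \<Longrightarrow> p \<in> cdom c \<Longrightarrow> \<omega> c p u = 0 \<Longrightarrow> \<omega> c p v = 0 \<Longrightarrow>
    gh c p u v = C p * g c p u v"
proof -
  have "\<exists>k. \<forall>c\<in>A. p \<in> cdom c \<longrightarrow> (\<forall>u v. \<omega> c p u = 0 \<longrightarrow> \<omega> c p v = 0 \<longrightarrow> gh c p u v = k * g c p u v)" for p
  proof -
    obtain d where d: "d \<in> A" "p \<in> cdom d"
      using smooth_atlas_cover[OF atlas] .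
    obtain \<eta> where \<eta>: "\<omega> d p \<eta> = 0" "g d p \<eta> \<eta> \<noteq> 0"
      using nonisotropic[OF d] .
    have pos: "dual_sum (\<omega> d p) (\<omega> d p) \<noteq> 0"
      using dual_sum_self_pos[OF one_formD(1)[OF form d]] form_nonzero[OF d] by (metis less_irrefl)
    \<comment> \<open>Proportionality with the reference pair (\<eta>, \<eta>); the powers of
      \<open>dual_sum (\<omega> d p) (\<omega> d p)\<close> introduced by \<open>kernel_form\<close>
      cancel.\<close>
    have k: "gh d p u v = gh d p \<eta> \<eta> / g d p \<eta> \<eta> * g d p u v" if "\<omega> d p u = 0" "\<omega> d p v = 0" for u v
      using kernel_forms_proportional[OF d, of u v \<eta> \<eta>] that \<eta> pos
      by (simp add: kernel_form_kernel field_simps)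
    have "gh c p u v = gh d p \<eta> \<eta> / g d p \<eta> \<eta> * g c p u v"
      if c: "c \<in> A" "p \<in> cdom c" and uv: "\<omega> c p u = 0" "\<omega> c p v = 0" for c u v
      using k[of "transfer c d p u" "transfer c d p v"] uv
        one_formD(3)[OF form c(1) d(1) c(2) d(2)] symmetric_two_tensorD(4)[OF tensor c(1) d(1) c(2) d(2)]
        symmetric_two_tensorD(4)[OF tensorh c(1) d(1) c(2) d(2)]
      by simp
    then show ?thesis by blast
  qed
  then show thesis
    using that by metis
qed

text \<open>C is the quotient of the component sum of products of the two kernel forms by the sum of
  squares for \<open>g\<close>; the latter is nonzero because a nonisotropic kernel vector exists at
  each point.\<close>

lemma smooth_conformal_factor:
  assumes C: "\<And>c p u v. c \<in> A \<Longrightarrow> p \<in> cdom c \<Longrightarrow> \<omega> c p u = 0 \<Longrightarrow> \<omega> c p v = 0 \<Longrightarrow>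
    gh c p u v = C p * g c p u v"
  shows "smooth_function A C"
  unfolding smooth_function_def
proof
  fix c assume c: "c \<in> A"
  interpret F: kropina_field "coord c ` cdom c" "\<lambda>x. \<omega> c (cinv c x)" "\<lambda>x. g c (cinv c x)"
    by (rule field[OF c])
  interpret Fh: kropina_field "coord c ` cdom c" "\<lambda>x. \<omega> c (cinv c x)" "\<lambda>x. gh c (cinv c x)"
    by (rule fieldh[OF c])
  let ?k = "\<lambda>x. kernel_form (\<omega> c (cinv c x)) (g c (cinv c x))"
    and ?kh = "\<lambda>x. kernel_form (\<omega> c (cinv c x)) (gh c (cinv c x))"
  let ?n = "\<lambda>x. \<Sum>b\<in>Basis. \<Sum>b'\<in>Basis. ?kh x b b' * ?k x b b'"
    and ?d = "\<lambda>x. \<Sum>b\<in>Basis. \<Sum>b'\<in>Basis. ?k x b b' * ?k x b b'"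
  have *: "?d x \<noteq> 0 \<and> ?n x / ?d x = C (cinv c x)" if x: "x \<in> coord c ` cdom c" for x
  proof -
    note p = chart(2)[OF c x]
    interpret J: kropina_1jet "\<omega> c (cinv c x)" "form_deriv (\<lambda>x. \<omega> c (cinv c x)) x" "g c (cinv c x)"
        "tensor_deriv (\<lambda>x. g c (cinv c x)) x"
      by (rule F.kropina_1jet[OF x])
    interpret Jh: kropina_1jet "\<omega> c (cinv c x)" "form_deriv (\<lambda>x. \<omega> c (cinv c x)) x" "gh c (cinv c x)"
        "tensor_deriv (\<lambda>x. gh c (cinv c x)) x"
      by (rule Fh.kropina_1jet[OF x])
    obtain \<eta> where \<eta>: "\<omega> c (cinv c x) \<eta> = 0" "g c (cinv c x) \<eta> \<eta> \<noteq> 0"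
      using nonisotropic[OF c p] .
    have "dual_sum (\<omega> c (cinv c x)) (\<omega> c (cinv c x)) \<noteq> 0"
      using dual_sum_self_pos[OF J.linear_form] J.nonzero by (metis less_irrefl)
    then have "?k x \<eta> \<eta> \<noteq> 0"
      using \<eta> by (simp add: kernel_form_kernel)
    moreover have "bilinear (?k x)"
      unfolding kernel_form_eq[OF J.linear_form J.bilinear_tensor J.sym, abs_def]
      by (auto simp: bilinear_def J.form_simps J.tensor_simps algebra_simps intro!: linearI)
    ultimately have "\<exists>b\<in>Basis. \<exists>b'\<in>Basis. ?k x b b' \<noteq> 0"
      using bilinear_expand[of "?k x" \<eta> \<eta>] by (metis (no_types, lifting) mult_zero_right sum.neutral)
    then have "?d x \<noteq> 0"
      by (auto simp: sum_nonneg_eq_0_iff sum_nonneg)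
    moreover have "?kh x u v = C (cinv c x) * ?k x u v" for u v
      unfolding kernel_form_eq[OF J.linear_form J.bilinear_tensor J.sym]
        kernel_form_eq[OF J.linear_form Jh.bilinear_tensor Jh.sym]
      by (rule C[OF c p]) (simp_all add: J.form_simps)
    then have "?n x = C (cinv c x) * ?d x"
      by (simp add: sum_distrib_left mult.assoc)
    ultimately show ?thesis
      by simp
  qed
  have "smooth_on (coord c ` cdom c) (\<lambda>x. ?n x / ?d x)"
    using * by (intro smooth_on_divide smooth_on_intros smooth_kernel_form F.smooth_form F.smooth_tensor
        Fh.smooth_tensor F.open_domain) blast
  then show "smooth_on (coord c ` cdom c) (C \<circ> cinv c)"
    using * by (elim smooth_on_cong[OF chart(5)[OF c], rotated]) simp
qed

end

section \<open>Constancy of the conformal factor and closedness of the 1-form\<close>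

context common_kernel
begin

lemma affine_relation:
  "\<exists>k \<beta>. k \<noteq> 0 \<and> one_form A \<beta> \<and> closed_form A \<beta> \<and>
    (\<forall>c\<in>A. \<forall>p\<in>cdom c. \<forall>\<xi>. \<omega> c p \<xi> \<noteq> 0 \<longrightarrow>
       kropina gh \<omega> c p \<xi> = k * kropina g \<omega> c p \<xi> + \<beta> c p \<xi>)"
proof -
  obtain C where C: "\<And>c p u v. c \<in> A \<Longrightarrow> p \<in> cdom c \<Longrightarrow> \<omega> c p u = 0 \<Longrightarrow> \<omega> c p v = 0 \<Longrightarrow>
      gh c p u v = C p * g c p u v"
    using conformal_factor by blast
  have smooth_C: "smooth_on (coord c ` cdom c) (\<lambda>x. C (cinv c x))" if "c \<in> A" for c
  proof -
    have "smooth_function A C"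
      by (rule smooth_conformal_factor) (rule C)
    then show ?thesis
      using that by (simp add: smooth_function_def o_def)
  qed
  \<comment> \<open>By the choice of C this tensor vanishes on pairs of kernel vectors, hence is a
    symmetrized product of \<omega> with a 1-form, namely \<beta>/2 + \<beta>/2.\<close>
  define h where "h c p u v = gh c p u v - C p * g c p u v" for c p u v
  define \<beta> where "\<beta> c p = perturbation_form (\<omega> c p) (h c p)" for c p
  have \<beta>: "linear (\<beta> c p)" "h c p u v = (\<omega> c p u * \<beta> c p v + \<omega> c p v * \<beta> c p u) / 2"
    if c: "c \<in> A" and p: "p \<in> cdom c" for c p u v
  proof -
    interpret J: kropina_1jet "\<omega> c p" "form_deriv (\<lambda>x. \<omega> c (cinv c x)) (coord c p)" "g c p"
        "tensor_deriv (\<lambda>x. g c (cinv c x)) (coord c p)"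
      by (rule jet(1)[OF c p])
    interpret Jh: kropina_1jet "\<omega> c p" "form_deriv (\<lambda>x. \<omega> c (cinv c x)) (coord c p)" "gh c p"
        "tensor_deriv (\<lambda>x. gh c (cinv c x)) (coord c p)"
      by (rule jet(2)[OF c p])
    obtain e where "\<omega> c p e \<noteq> 0" using J.nonzero by blast
    moreover have "bilinear (h c p)"
      by (auto simp: bilinear_def h_def J.tensor_simps Jh.tensor_simps algebra_simps intro!: linearI)
    moreover have "h c p u v = h c p v u" for u v
      using J.sym[of u v] Jh.sym[of u v] by (simp add: h_def)
    moreover have "h c p u v = 0" if "\<omega> c p u = 0" "\<omega> c p v = 0" for u v
      using C[OF c p that] by (simp add: h_def)
    ultimately show "linear (\<beta> c p)" "h c p u v = (\<omega> c p u * \<beta> c p v + \<omega> c p v * \<beta> c p u) / 2"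
      unfolding \<beta>_def using perturbation_form[OF J.linear_form] by blast+
  qed
  have smooth_\<beta>: "smooth_on (coord c ` cdom c) (\<lambda>x. \<beta> c (cinv c x) v)" if c: "c \<in> A" for c v
  proof -
    interpret F: kropina_field "coord c ` cdom c" "\<lambda>x. \<omega> c (cinv c x)" "\<lambda>x. g c (cinv c x)"
      by (rule field[OF c])
    interpret Fh: kropina_field "coord c ` cdom c" "\<lambda>x. \<omega> c (cinv c x)" "\<lambda>x. gh c (cinv c x)"
      by (rule fieldh[OF c])
    have "smooth_on (coord c ` cdom c) (\<lambda>x. h c (cinv c x) u v)" for u v
      unfolding h_def
      by (intro smooth_on_intros F.open_domain smooth_C[OF c] F.smooth_tensor Fh.smooth_tensor)
    then show ?thesis
      unfolding \<beta>_def
      using smooth_perturbation_form[where w = "\<lambda>x. \<omega> c (cinv c x)" and h = "\<lambda>x. h c (cinv c x)"]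
        F.open_domain F.smooth_form F.linear_field F.nonzero_field by blast
  qed
  have dC0: "frechet_derivative (\<lambda>x. C (cinv c x)) (at (coord c p)) z = 0"
    and closed: "ext_deriv \<beta> c p y z = 0" if c: "c \<in> A" and p: "p \<in> cdom c" for c p y z
  proof -
    let ?x = "coord c p"
    let ?C = "\<lambda>x. C (cinv c x)" and ?B = "\<lambda>x. \<beta> c (cinv c x)"
    have x: "?x \<in> coord c ` cdom c" using p by simp
    note px = chart(1)[OF c p]
    interpret J: kropina_1jet "\<omega> c p" "form_deriv (\<lambda>x. \<omega> c (cinv c x)) ?x" "g c p"
        "tensor_deriv (\<lambda>x. g c (cinv c x)) ?x"
      by (rule jet(1)[OF c p])
    have dC: "?C differentiable (at ?x)"
      by (rule smooth_on_differentiable[OF smooth_C[OF c] x])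
    have dB: "(\<lambda>x. ?B x v) differentiable (at ?x)" for v
      by (rule smooth_on_differentiable[OF smooth_\<beta>[OF c] x])
    \<comment> \<open>Required on the whole chart image, because \<open>kropina_perturbation\<close>
      differentiates it at the point.\<close>
    have eq: "gh c (cinv c y) u v = ?C y * g c (cinv c y) u v
        + (\<omega> c (cinv c y) u * ?B y v + \<omega> c (cinv c y) v * ?B y u) / 2" if "y \<in> coord c ` cdom c" for y u v
      using \<beta>(2)[OF c chart(2)[OF c that], of u v] unfolding h_def by linarith
    obtain W where W: "open W" "W \<noteq> {}" "\<And>\<xi>. \<xi> \<in> W \<Longrightarrow> \<exists>a.
      geodesic_2jet (\<omega> c (cinv c ?x)) (form_deriv (\<lambda>x. \<omega> c (cinv c x)) ?x)
        (g c (cinv c ?x)) (tensor_deriv (\<lambda>x. g c (cinv c x)) ?x) \<xi> a \<and>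
      geodesic_2jet (\<omega> c (cinv c ?x)) (form_deriv (\<lambda>x. \<omega> c (cinv c x)) ?x)
        (gh c (cinv c ?x)) (tensor_deriv (\<lambda>x. gh c (cinv c x)) ?x) \<xi> a"
      using common_geodesic_2jets[OF atlas pair nondeg pairh nondegh equiv c x] by blast
    let ?\<theta> = "\<lambda>u v. form_deriv ?B ?x u v - form_deriv ?B ?x v u"
    have pert: "\<omega> c p \<xi> * (2 * frechet_derivative ?C (at ?x) \<xi> * g c p \<xi> v
        - frechet_derivative ?C (at ?x) v * g c p \<xi> \<xi> + \<omega> c p \<xi> * ?\<theta> \<xi> v) = 0"
      if \<xi>: "\<xi> \<in> W" and v: "\<omega> c p v = 0" for \<xi> v
    proof -
      obtain a where a: "geodesic_2jet (\<omega> c (cinv c ?x)) (form_deriv (\<lambda>x. \<omega> c (cinv c x)) ?x)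
          (g c (cinv c ?x)) (tensor_deriv (\<lambda>x. g c (cinv c x)) ?x) \<xi> a"
        "geodesic_2jet (\<omega> c (cinv c ?x)) (form_deriv (\<lambda>x. \<omega> c (cinv c x)) ?x)
          (gh c (cinv c ?x)) (tensor_deriv (\<lambda>x. gh c (cinv c x)) ?x) \<xi> a"
        using W(3)[OF \<xi>] by blast
      show ?thesis
        using kropina_perturbation[OF field[OF c] fieldh[OF c] x dC dB eq a] v unfolding px by blast
    qed
    have bil: "bilinear (form_deriv ?B ?x)"
      by (rule bilinear_form_deriv[OF chart(5)[OF c] x \<beta>(1)[OF c chart(2)[OF c]] dB])
    then have bil\<theta>: "bilinear ?\<theta>"
      by (auto simp: bilinear_def linear_iff algebra_simps)
    obtain u where u: "\<omega> c p u = 0" "u \<noteq> 0"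
      using kernel_nontrivial[OF atlas pair nondeg nonint c p] .
    have lin: "linear (frechet_derivative ?C (at ?x))"
      by (rule linear_frechet_derivative[OF dC])
    show "frechet_derivative ?C (at ?x) z = 0"
      by (rule J.dform_eq_0_of_conformal_perturbation(1)[OF u lin bil\<theta> _ W(1,2) pert]) simp
    show "ext_deriv \<beta> c p y z = 0"
      unfolding ext_deriv_form_deriv
      by (rule J.dform_eq_0_of_conformal_perturbation(2)[OF u lin bil\<theta> _ W(1,2) pert]) simp
  qed
  \<comment> \<open>Chart domains may be disconnected; local constancy is obtained on preimages of
    coordinate balls, and connectedness of the manifold does the rest.\<close>
  have "C constant_on UNIV"
  proof (rule locally_constant_imp_constant)
    show "connected (UNIV :: 'm set)" by (rule connected)
    fix p :: 'm
    obtain c where c: "c \<in> A" "p \<in> cdom c"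
      using smooth_atlas_cover[OF atlas] .
    obtain r where r: "r > 0" "ball (coord c p) r \<subseteq> coord c ` cdom c"
      using open_contains_ball[of "coord c ` cdom c"] chart(5)[OF c(1)] c(2) by blast
    have deriv: "((\<lambda>x. C (cinv c x)) has_derivative (\<lambda>_. 0)) (at x within ball (coord c p) r)"
      if "x \<in> ball (coord c p) r" for x
    proof -
      have x: "x \<in> coord c ` cdom c" using that r(2) by blast
      have "frechet_derivative (\<lambda>x. C (cinv c x)) (at x) = (\<lambda>_. 0)"
        using dC0[OF c(1) chart(2)[OF c(1) x]] chart(3)[OF c(1) x] by auto
      then show ?thesis
        using frechet_has_derivative[OF smooth_on_differentiable[OF smooth_C[OF c(1)] x]]
        by (simp add: has_derivative_at_withinI)
    qed
    obtain k where k: "\<And>x. x \<in> ball (coord c p) r \<Longrightarrow> C (cinv c x) = k"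
      using has_derivative_zero_constant[OF convex_ball deriv] by blast
    let ?T = "cdom c \<inter> coord c -` ball (coord c p) r"
    have "open ?T"
      by (rule continuous_open_preimage[OF chart(6)[OF c(1)] chart(4)[OF c(1)] open_ball])
    moreover have "p \<in> ?T" using c r by simp
    moreover have "C q = k" if "q \<in> ?T" for q
      using k[of "coord c q"] that chart(1)[OF c(1)] by auto
    ultimately show "\<exists>T. openin (top_of_set UNIV) T \<and> p \<in> T \<and> (\<forall>q\<in>T. C q = C p)"
      by (intro exI[of _ ?T]) auto
  qed
  then obtain k where k: "\<And>p. C p = k"
    by (auto simp: constant_on_def)
  have "k \<noteq> 0"
  proof
    assume "k = 0"
    \<comment> \<open>\<open>undefined\<close> is just some point of the manifold. With k = 0 the
      tensor \<open>gh\<close> would vanish on a nontrivial kernel, against its nondegeneracy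
      there.\<close>
    obtain c where c: "c \<in> A" "undefined \<in> cdom c"
      using smooth_atlas_cover[OF atlas] .
    obtain u where u: "\<omega> c undefined u = 0" "u \<noteq> 0"
      using kernel_nontrivial[OF atlas pair nondeg nonint c] .
    then have "u = 0"
      using C[OF c] k \<open>k = 0\<close> kropina_1jet.nondegenerate[OF jet(2)[OF c] u(1)] by simp
    with u show False by simp
  qed
  moreover have "one_form A \<beta>"
    unfolding one_form_def
  proof (intro conjI ballI allI)
    fix c d p v assume c: "c \<in> A" and d: "d \<in> A" and p: "p \<in> cdom c \<inter> cdom d"
    then have pc: "p \<in> cdom c" and pd: "p \<in> cdom d" by auto
    obtain e where e: "\<omega> c p e \<noteq> 0" using form_nonzero[OF c pc] by blast
    \<comment> \<open>The tensor h and the form \<omega> transform correctly, and \<omega>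
      determines \<beta> from h.\<close>
    show "\<beta> d p (transfer c d p v) = \<beta> c p v"
    proof (rule symmetrized_product_unique[where \<omega> = "\<omega> c p" and f = "\<lambda>v. \<beta> d p (transfer c d p v)", OF _ e])
      fix u v
      have "h d p (transfer c d p u) (transfer c d p v) = h c p u v"
        using symmetric_two_tensorD(4)[OF tensor c d pc pd] symmetric_two_tensorD(4)[OF tensorh c d pc pd]
        by (simp add: h_def)
      then show "\<omega> c p u * \<beta> d p (transfer c d p v) + \<omega> c p v * \<beta> d p (transfer c d p u)
          = \<omega> c p u * \<beta> c p v + \<omega> c p v * \<beta> c p u"
        unfolding \<beta>(2)[OF c pc] \<beta>(2)[OF d pd] one_formD(3)[OF form c d pc pd] by simp
    qed
  qed (use \<beta>(1) smooth_\<beta> in auto)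
  moreover have "closed_form A \<beta>"
    using closed by (simp add: closed_form_def)
  moreover have "kropina gh \<omega> c p \<xi> = k * kropina g \<omega> c p \<xi> + \<beta> c p \<xi>"
    if "c \<in> A" "p \<in> cdom c" "\<omega> c p \<xi> \<noteq> 0" for c p \<xi>
    using \<beta>(2)[OF that(1,2), of \<xi> \<xi>] that(3) by (simp add: kropina_def h_def k field_simps)
  ultimately show ?thesis
    by blast
qed

end

section \<open>Reduction to a common 1-form\<close>

lemma kropina_geodesic_cong:
  assumes atlas: "smooth_atlas A"
    and eq: "\<And>c p \<xi>. c \<in> A \<Longrightarrow> p \<in> cdom c \<Longrightarrow> kropina g \<omega> c p \<xi> = kropina g' \<omega>' c p \<xi>"
    and nz: "\<And>c p \<xi>. c \<in> A \<Longrightarrow> p \<in> cdom c \<Longrightarrow> \<omega> c p \<xi> \<noteq> 0 \<Longrightarrow> \<omega>' c p \<xi> \<noteq> 0"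
    and geo: "kropina_geodesic A g \<omega> (I, \<gamma>)"
  shows "kropina_geodesic A g' \<omega>' (I, \<gamma>)"
proof -
  have reg: "smooth_regular_curve A (I, \<gamma>)" and EL: "euler_lagrange A (kropina g \<omega>) (I, \<gamma>)"
    using geo by (auto simp: kropina_geodesic_def)
  have "euler_lagrange A (kropina g' \<omega>') (I, \<gamma>)"
    unfolding euler_lagrange_def split
  proof (intro ballI impI allI)
    fix c t v assume c: "c \<in> A" and t: "t \<in> I" "\<gamma> t \<in> cdom c"
    note ch = chart_inverse[OF smooth_atlas_chart[OF atlas c]]
    have "open I" "continuous_on I \<gamma>"
      using reg by (auto simp: smooth_regular_curve_def)
    then have T: "open {s \<in> I. \<gamma> s \<in> cdom c}" "t \<in> {s \<in> I. \<gamma> s \<in> cdom c}"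
      using continuous_open_preimage[OF _ _ ch(4)] t by (auto simp: vimage_def Int_def)
    have "frechet_derivative (\<lambda>x. kropina g \<omega> c (cinv c x) (velocity c \<gamma> t)) (at (coord c (\<gamma> t))) =
      frechet_derivative (\<lambda>x. kropina g' \<omega>' c (cinv c x) (velocity c \<gamma> t)) (at (coord c (\<gamma> t)))"
      using t by (intro frechet_derivative_cong_open[OF ch(5)]) (auto simp: eq[OF c] ch)
    moreover have "((\<lambda>s. frechet_derivative (\<lambda>\<xi>. kropina g \<omega> c (\<gamma> s) \<xi>) (at (velocity c \<gamma> s)) v) has_real_derivative
      frechet_derivative (\<lambda>x. kropina g \<omega> c (cinv c x) (velocity c \<gamma> t)) (at (coord c (\<gamma> t))) v) (at t)"
      using EL c t by (auto simp: euler_lagrange_def)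
    ultimately have "((\<lambda>s. frechet_derivative (\<lambda>\<xi>. kropina g \<omega> c (\<gamma> s) \<xi>) (at (velocity c \<gamma> s)) v) has_real_derivative
      frechet_derivative (\<lambda>x. kropina g' \<omega>' c (cinv c x) (velocity c \<gamma> t)) (at (coord c (\<gamma> t))) v) (at t)"
      by simp
    then show "((\<lambda>s. frechet_derivative (\<lambda>\<xi>. kropina g' \<omega>' c (\<gamma> s) \<xi>) (at (velocity c \<gamma> s)) v) has_real_derivative
      frechet_derivative (\<lambda>x. kropina g' \<omega>' c (cinv c x) (velocity c \<gamma> t)) (at (coord c (\<gamma> t))) v) (at t)"
      by (rule has_field_derivative_transform_within_open[OF _ T]) (simp add: eq[OF c])
  qed
  then show ?thesis
    using geo nz by (auto simp: kropina_geodesic_def)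
qed

theorem theorem1p2:
  fixes A :: "('m::{t2_space,second_countable_topology}, 'e::euclidean_space) chart set"
    and g gh :: "('m, 'e) two_tensor"
    and \<omega> \<omega>h :: "('m, 'e) tangent_function"
  assumes "smooth_atlas A" and "connected (UNIV :: 'm set)"
    and "kropina_pair A g \<omega>" and "kropina_pair A gh \<omega>h"
    and "projectively_equivalent A g \<omega> gh \<omega>h"
    and "kernel_nonintegrable_ae A \<omega>"
    and "nondegenerate_on_kernel A g \<omega>" and "nondegenerate_on_kernel A gh \<omega>h"
  shows "(\<exists>\<alpha>. smooth_function A \<alpha> \<and> (\<forall>p. \<alpha> p \<noteq> 0) \<and>
            (\<forall>c\<in>A. \<forall>p\<in>cdom c. \<forall>v. \<omega> c p v = \<alpha> p * \<omega>h c p v)) \<and>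
         (\<exists>k \<beta>. k \<noteq> 0 \<and> one_form A \<beta> \<and> closed_form A \<beta> \<and>
            (\<forall>c\<in>A. \<forall>p\<in>cdom c. \<forall>\<xi>. \<omega> c p \<xi> \<noteq> 0 \<longrightarrow>
               kropina gh \<omega>h c p \<xi> = k * kropina g \<omega> c p \<xi> + \<beta> c p \<xi>))"
proof -
  note atlas = assms(1) and pair = assms(3) and pairh = assms(4) and equiv = assms(5)
    and nonint = assms(6) and nondeg = assms(7) and nondegh = assms(8)
  have form: "one_form A \<omega>" "one_form A \<omega>h"
    and nz: "\<And>c p. c \<in> A \<Longrightarrow> p \<in> cdom c \<Longrightarrow> \<exists>v. \<omega> c p v \<noteq> 0"
      "\<And>c p. c \<in> A \<Longrightarrow> p \<in> cdom c \<Longrightarrow> \<exists>v. \<omega>h c p v \<noteq> 0"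
    and tensorh: "symmetric_two_tensor A gh"
    using pair pairh by (auto simp: kropina_pair_def)
  obtain \<alpha> where \<alpha>: "smooth_function A \<alpha>" "\<And>p. \<alpha> p \<noteq> 0"
      "\<And>c p v. c \<in> A \<Longrightarrow> p \<in> cdom c \<Longrightarrow> \<omega> c p v = \<alpha> p * \<omega>h c p v"
    using conformal_factor_of_forms[OF atlas form(1) nz(1) form(2) nz(2)
        forms_proportional[OF atlas pair nondeg pairh nondegh equiv nonint]] by blast
  \<comment> \<open>Numerator and denominator of the second metric are multiplied by \<alpha>: the
    function stays the same, while its denominator becomes \<omega>.\<close>
  define g' where "g' c p u v = \<alpha> p * gh c p u v" for c p u v
  \<comment> \<open>The equality covers all vectors; on the kernel both sides have the default value
    0 of division by zero. Hence the derivatives in the Euler-Lagrange equations agree as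
    well.\<close>
  have kropina_g': "kropina gh \<omega>h c p \<xi> = kropina g' \<omega> c p \<xi>" if "c \<in> A" "p \<in> cdom c" for c p \<xi>
    using \<alpha>(2)[of p] by (simp add: kropina_def g'_def \<alpha>(3)[OF that])
  have "symmetric_two_tensor A g'"
    unfolding symmetric_two_tensor_def
  proof (intro conjI ballI allI)
    fix c u v assume c: "c \<in> A"
    note T = symmetric_two_tensorD[OF tensorh c]
    show "smooth_on (coord c ` cdom c) (\<lambda>x. g' c (cinv c x) u v)"
      unfolding g'_def
      using \<alpha>(1) c smooth_on_mult[OF chart_inverse(5)[OF smooth_atlas_chart[OF atlas c]] _ T(3)]
      by (simp add: smooth_function_def o_def)
    fix p assume p: "p \<in> cdom c"
    have "linear (\<lambda>x. \<alpha> p * f x)" if "linear f" for f :: "'e \<Rightarrow> real"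
      using linear_compose_scale_right[OF that, of "\<alpha> p"] by simp
    then show "bilinear (g' c p)"
      using T(1)[OF p] by (auto simp: bilinear_def g'_def[abs_def])
    show "g' c p u v = g' c p v u"
      using T(2)[OF p] by (simp add: g'_def)
  next
    fix c d p u v assume "c \<in> A" "d \<in> A" "p \<in> cdom c \<inter> cdom d"
    then show "g' d p (transfer c d p u) (transfer c d p v) = g' c p u v"
      using symmetric_two_tensorD(4)[OF tensorh] by (simp add: g'_def)
  qed
  then have pair': "kropina_pair A g' \<omega>"
    using pair by (simp add: kropina_pair_def)
  have nondeg': "nondegenerate_on_kernel A g' \<omega>"
    using nondegh unfolding nondegenerate_on_kernel_def g'_def
    by (simp add: \<alpha>(2,3))
  have "unparameterized_geodesic A g' \<omega> \<Gamma>" if "unparameterized_geodesic A gh \<omega>h \<Gamma>" for \<Gamma>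
    using that kropina_geodesic_cong[OF atlas kropina_g'] \<alpha>(2,3)
    unfolding unparameterized_geodesic_def by (metis mult_eq_0_iff surj_pair)
  then have equiv': "projectively_equivalent A g \<omega> g' \<omega>"
    using equiv unfolding projectively_equivalent_def by blast
  interpret common_kernel A g g' \<omega>
    by unfold_locales (use atlas assms(2) pair nondeg pair' nondeg' equiv' nonint in blast)+
  have "\<exists>k \<beta>. k \<noteq> 0 \<and> one_form A \<beta> \<and> closed_form A \<beta> \<and>
      (\<forall>c\<in>A. \<forall>p\<in>cdom c. \<forall>\<xi>. \<omega> c p \<xi> \<noteq> 0 \<longrightarrow>
         kropina gh \<omega>h c p \<xi> = k * kropina g \<omega> c p \<xi> + \<beta> c p \<xi>)"
    using affine_relation kropina_g' by simp
  with \<alpha> show ?thesis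
    by blast
qed

end
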